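(* Let $D = \{-, 0, +\}$ be a set of three distinct symbols. Let $$P = \{(-,-,-),\ (-,0,-),\ (-,+,-),\ (-,+,0),\ (-,+,+),\ (0,-,-)\} \subseteq D^3, \qquad Q = P \cup \{(0,0,0)\},$$ and let $$R := (P \times \{0\}) \cup (Q \times \{+\}) \subseteq D^4.$$ Then, for positive integers $n$, $$\mathrm{NRD}(R, n) \leq O\big(n \cdot f^{(3)}(n, 6, 3)\big) \le \frac{n^3}{2^{\Omega(\log^*(n))}}$$ and $$\mathrm{CL}(R, n) \geq \Omega(n^3).$$
   Context: Given a relation $R \subseteq D^r$ over a finite domain $D$, an instance of $\mathrm{CSP}(R)$ is a pair $(V, C)$ with $V$ a finite set of variables (typically $V = [n] = \{1,\dots,n\}$) and $C \subseteq V^r$ a set of constraints. For an assignment $\varphi : V \to D$ and $S = (v_1,\dots,v_r) \in C$, write $\varphi(S) := (\varphi(v_1),\dots,\varphi(v_r))$; the constraint $S$ is satisfied by $\varphi$ if $\varphi(S) \in R$. An instance on variables $[n]$ with constraints $S_1,\dots,S_m$ is non-redundant if for each $i \in [m]$ there is an assignment $\varphi_i : [n] \to D$ with $\varphi_i(S_i) \notin R$ and $\varphi_i(S_j) \in R$ for all $j \in [m]$ with $j \neq i$. $\mathrm{NRD}(R,n)$ is the maximum $m$ such that there is a non-redundant instance of $\mathrm{CSP}(R)$ with $n$ variables and $m$ constraints. An instance on variables $[n]$ with an ordered list of constraints $S_1,\dots,S_m$ is a valid witness to chain length if for each $i \in [m]$ there is an assignment $\varphi_i : [n] \to D$ with $\varphi_i(S_i)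 \notin R$ and $\varphi_i(S_j) \in R$ for all $j < i$. $\mathrm{CL}(R,n)$ is the maximum $m$ such that there is an instance of $\mathrm{CSP}(R)$ with $n$ variables and $m$ constraints that is a valid witness to chain length. $f^{(3)}(n,6,3)$ is the maximum number of hyperedges in a $3$-uniform hypergraph on $n$ vertices such that no $6$ vertices completely contain $3$ hyperedges. $\log^*(n)$ is the iterated logarithm: the number of times $\log_2$ must be applied to $n$ before the result is at most $1$. Asymptotic notation is as $n \to \infty$: there are constants $c_1,c_2,c_3>0$ and $n_0$ such that for all $n \ge n_0$: $\mathrm{NRD}(R,n) \le c_1\, n\, f^{(3)}(n,6,3)$, $c_1\, n\, f^{(3)}(n,6,3) \le n^3/2^{c_2\log^*(n)}$, and $\mathrm{CL}(R,n) \ge c_3 n^3$. *)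

theory Defs
  imports Complex_Main
begin

section \<open>Constraint satisfaction problems\<close>

text \<open>
  The domain \<open>D\<close> is a finite type; a tuple in \<open>D\<^sup>r\<close> or \<open>V\<^sup>r\<close> is a list of length \<open>r\<close>, and a
  relation \<open>R \<subseteq> D\<^sup>r\<close> is a set of such lists.  An assignment \<open>V \<Rightarrow> D\<close> is taken as a total
  function; values outside \<open>V\<close> never matter, because every constraint of an instance lies over \<open>V\<close>.
\<close>

definition tuples :: "nat \<Rightarrow> 'a set \<Rightarrow> 'a list set" where
  "tuples r A = {xs. length xs = r \<and> set xs \<subseteq> A}"

definition csp_instance :: "nat \<Rightarrow> 'v set \<Rightarrow> 'v list set \<Rightarrow> bool" where
  "csp_instance r V C \<longleftrightarrow> finite V \<and> C \<subseteq> tuples r V"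

definition satisfies :: "('d::finite) list set \<Rightarrow> ('v \<Rightarrow> 'd) \<Rightarrow> 'v list \<Rightarrow> bool" where
  "satisfies R \<phi> S \<longleftrightarrow> map \<phi> S \<in> R"

definition non_redundant :: "('d::finite) list set \<Rightarrow> 'v list set \<Rightarrow> bool" where
  "non_redundant R C \<longleftrightarrow>
     (\<forall>S\<in>C. \<exists>\<phi>. \<not> satisfies R \<phi> S \<and> (\<forall>T\<in>C. T \<noteq> S \<longrightarrow> satisfies R \<phi> T))"

definition chain_witness :: "('d::finite) list set \<Rightarrow> 'v list list \<Rightarrow> bool" where
  "chain_witness R Ss \<longleftrightarrow>
     (\<forall>i<length Ss. \<exists>\<phi>. \<not> satisfies R \<phi> (Ss ! i) \<and> (\<forall>j<i. satisfies R \<phi> (Ss ! j)))"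

text \<open>
  The first argument \<open>r\<close> is the arity of \<open>R\<close>.  The maxima below range over finite nonempty sets,
  see \<open>NRD_sizes\<close> and \<open>CL_sizes\<close>.
\<close>

definition NRD :: "nat \<Rightarrow> ('d::finite) list set \<Rightarrow> nat \<Rightarrow> nat" where
  "NRD r R n = Max {m. \<exists>C :: nat list set.
     csp_instance r {1..n} C \<and> non_redundant R C \<and> card C = m}"

definition CL :: "nat \<Rightarrow> ('d::finite) list set \<Rightarrow> nat \<Rightarrow> nat" where
  "CL r R n = Max {m. \<exists>Ss :: nat list list.
     csp_instance r {1..n} (set Ss) \<and> chain_witness R Ss \<and> length Ss = m}"

lemma finite_tuples: "finite A \<Longrightarrow> finite (tuples r A)"
  unfolding tuples_def using finite_lists_length_eq[of A r] by (simp add: conj_commute)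

text \<open>The listed constraints are automatically distinct, so \<open>length Ss\<close> is the number of
  constraints of the instance.\<close>

lemma chain_witness_distinct:
  assumes "chain_witness R Ss"
  shows "distinct Ss"
proof -
  have "Ss ! i \<noteq> Ss ! j" if ij: "i < length Ss" "j < i" for i j
  proof -
    obtain \<phi> where "\<not> satisfies R \<phi> (Ss ! i)" "satisfies R \<phi> (Ss ! j)"
      using assms ij unfolding chain_witness_def by blast
    then show ?thesis by auto
  qed
  then show ?thesis
    unfolding distinct_conv_nth by (metis linorder_neqE_nat)
qed

lemma NRD_sizes:
  fixes R :: "('d::finite) list set" and r n :: nat
  defines "M \<equiv> {m. \<exists>C :: nat list set. csp_instance r {1..n} C \<and> non_redundant R C \<and> card C = m}"
  shows "finite M" "M \<noteq> {}"
proof -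
  have "M \<subseteq> card ` Pow (tuples r {1..n})"
    unfolding M_def csp_instance_def by auto
  then show "finite M"
    by (rule finite_subset) (simp add: finite_tuples)
  have "0 \<in> M"
    unfolding M_def csp_instance_def non_redundant_def
    by (intro CollectI exI[of _ "{}"]) simp
  then show "M \<noteq> {}" by blast
qed

lemma CL_sizes:
  fixes R :: "('d::finite) list set" and r n :: nat
  defines "M \<equiv> {m. \<exists>Ss :: nat list list.
     csp_instance r {1..n} (set Ss) \<and> chain_witness R Ss \<and> length Ss = m}"
  shows "finite M" "M \<noteq> {}"
proof -
  have "M \<subseteq> {..card (tuples r {1..n})}"
  proof
    fix m assume "m \<in> M"
    then obtain Ss :: "nat list list" where Ss: "set Ss \<subseteq> tuples r {1..n}"
      "chain_witness R Ss" "length Ss = m"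
      unfolding M_def csp_instance_def by auto
    then have "m = card (set Ss)"
      using chain_witness_distinct distinct_card by metis
    also have "\<dots> \<le> card (tuples r {1..n})"
      by (intro card_mono finite_tuples finite_atLeastAtMost Ss)
    finally show "m \<in> {..card (tuples r {1..n})}" by simp
  qed
  then show "finite M"
    by (rule finite_subset) simp
  have "0 \<in> M"
    unfolding M_def csp_instance_def chain_witness_def
    by (intro CollectI exI[of _ "[]"]) simp
  then show "M \<noteq> {}" by blast
qed

section \<open>The relation \<open>R\<close>\<close>

datatype sgn3 = Neg | Zero | Pos

instance sgn3 :: finite
proof
  have "UNIV = {Neg, Zero, Pos}"
    using sgn3.exhaust by auto
  then show "finite (UNIV :: sgn3 set)"
    by (metis finite.emptyI finite.insertI)
qed

definition P_rel :: "sgn3 list set" where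
  "P_rel = {[Neg, Neg, Neg], [Neg, Zero, Neg], [Neg, Pos, Neg],
            [Neg, Pos, Zero], [Neg, Pos, Pos], [Zero, Neg, Neg]}"

definition Q_rel :: "sgn3 list set" where
  "Q_rel = P_rel \<union> {[Zero, Zero, Zero]}"

definition R_rel :: "sgn3 list set" where
  "R_rel = {p @ [Zero] |p. p \<in> P_rel} \<union> {q @ [Pos] |q. q \<in> Q_rel}"

lemma R_rel_arity: "R_rel \<subseteq> tuples 4 UNIV"
  by (auto simp: R_rel_def Q_rel_def P_rel_def tuples_def)

section \<open>Hypergraphs and the iterated logarithm\<close>

text \<open>
  \<open>hyp_extremal r n v e\<close> is \<open>f\<^sup>(\<^sup>r\<^sup>)(n, v, e)\<close>: the largest number of edges of an \<open>r\<close>-uniform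
  hypergraph on \<open>n\<close> vertices in which every \<open>v\<close>-set of vertices contains fewer than \<open>e\<close> edges.
\<close>

definition uniform_hypergraph :: "nat \<Rightarrow> 'a set \<Rightarrow> 'a set set \<Rightarrow> bool" where
  "uniform_hypergraph r V E \<longleftrightarrow> finite V \<and> (\<forall>h\<in>E. h \<subseteq> V \<and> card h = r)"

definition sparse_hypergraph :: "nat \<Rightarrow> nat \<Rightarrow> 'a set \<Rightarrow> 'a set set \<Rightarrow> bool" where
  "sparse_hypergraph v e V E \<longleftrightarrow>
     \<not> (\<exists>W. W \<subseteq> V \<and> card W = v \<and> card {h\<in>E. h \<subseteq> W} \<ge> e)"

definition hyp_extremal :: "nat \<Rightarrow> nat \<Rightarrow> nat \<Rightarrow> nat \<Rightarrow> nat" where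
  "hyp_extremal r n v e = Max {m. \<exists>E :: nat set set.
     uniform_hypergraph r {1..n} E \<and> sparse_hypergraph v e {1..n} E \<and> card E = m}"

lemma hyp_extremal_sizes:
  fixes r n v e :: nat
  assumes "e > 0"
  defines "M \<equiv> {m. \<exists>E :: nat set set.
     uniform_hypergraph r {1..n} E \<and> sparse_hypergraph v e {1..n} E \<and> card E = m}"
  shows "finite M" "M \<noteq> {}"
proof -
  have "M \<subseteq> card ` Pow (Pow {1..n})"
    unfolding M_def uniform_hypergraph_def by auto
  then show "finite M"
    by (rule finite_subset) simp
  have "0 \<in> M"
    using assms(1) unfolding M_def uniform_hypergraph_def sparse_hypergraph_def
    by (intro CollectI exI[of _ "{}"]) simp
  then show "M \<noteq> {}" by blast
qed

definition log_star :: "real \<Rightarrow> nat" where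
  "log_star x = (LEAST k. (log 2 ^^ k) x \<le> 1)"

lemma log_star_exists: "\<exists>k. (log 2 ^^ k) x \<le> 1"
proof -
  have "\<exists>k. (log 2 ^^ k) x \<le> 1" if "x \<le> 1 + real N" for N x
    using that
  proof (induction N arbitrary: x)
    case 0
    then show ?case by (auto intro: exI[of _ 0])
  next
    case (Suc N)
    show ?case
    proof (cases "x \<le> 2")
      case True
      show ?thesis
      proof (cases "x \<le> 1")
        case True
        then show ?thesis by (auto intro: exI[of _ 0])
      next
        case False
        with \<open>x \<le> 2\<close> have "log 2 x \<le> 1" by simp
        then show ?thesis by (auto intro: exI[of _ 1])
      qed
    next
      case False
      have "1/2 \<le> ln (2::real)"
        using ln_add_one_self_le_self2[of "-1/2"] by (simp add: ln_div)
      have "log 2 x = 1 + ln (x / 2) / ln 2"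
        using False by (simp add: log_def ln_div field_simps)
      also have "ln (x / 2) / ln 2 \<le> (x / 2 - 1) / ln 2"
        using False by (intro divide_right_mono) (simp_all add: ln_le_minus_one)
      also have "(x / 2 - 1) / ln 2 \<le> (x / 2 - 1) / (1/2)"
        using False \<open>1/2 \<le> ln 2\<close> by (intro divide_left_mono) auto
      finally have "log 2 x \<le> x - 1"
        by simp
      then have "log 2 x \<le> 1 + real N"
        using Suc.prems by simp
      from Suc.IH[OF this] obtain k where "(log 2 ^^ k) (log 2 x) \<le> 1" ..
      then have "(log 2 ^^ Suc k) x \<le> 1"
        by (simp only: funpow_Suc_right o_apply)
      then show ?thesis by blast
    qed
  qed
  moreover have "x \<le> 1 + real (nat \<lceil>x\<rceil>)"
    by linarith
  ultimately show ?thesis by blast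
qed

end

theory Submission
  imports Defs "HOL-Library.FuncSet"
begin

text \<open>
  Upper bound on \<open>f\<^sup>(\<^sup>3\<^sup>)(n, 6, 3)\<close>, after Fox's proof of the graph removal lemma. Apart from
  \<open>O(n)\<close> edges, a \<open>(6, 3)\<close>-free hypergraph is a set \<open>T\<close> of triples \<open>(a, b, c)\<close> such that, for
  each \<open>c\<close>, the pairs \<open>(a, b)\<close> with \<open>(a, b, c) \<in> T\<close> form an induced matching between vertex
  sets \<open>X\<^sub>c\<close> and \<open>Y\<^sub>c\<close> in the graph \<open>G\<close> of all pairs; hence \<open>X\<^sub>c \<times> Y\<^sub>c\<close> carries almost no
  edges of \<open>G\<close>. A finite set \<open>F\<close> of indices \<open>c\<close> partitions both sides by membership in the
  sets \<open>X\<^sub>c\<close>, \<open>Y\<^sub>c\<close> with \<open>c \<in> F\<close>. In each pair of parts, a bounded number of rectangles \<open>X\<^sub>c \<times>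
  Y\<^sub>c\<close> captures almost all of every other such rectangle. If their union \<open>S\<close> fills half of the
  pair of parts, then the edges of \<open>G\<close>, which avoid \<open>S\<close>, are unevenly distributed; otherwise
  the \<open>X\<^sub>c\<close> or the \<open>Y\<^sub>c\<close> are. Either way, adding these indices to \<open>F\<close> increases a total
  entropy by a constant multiple of \<open>card T\<close>, while the entropy lies between \<open>3 card T ln
  (card T / n\<^sup>2)\<close> and \<open>0\<close>. So the number of exponential refinement steps is only logarithmic
  in the inverse density.

  Upper bound on \<open>NRD\<close>. The assignment violating a constraint \<open>(x, y, z, w)\<close> either gives \<open>w\<close>
  the value \<open>-\<close>, or maps \<open>(x, y, z)\<close> outside \<open>Q\<close>, or maps all four variables to \<open>0\<close>. The first
  two kinds are quadratic in number. For a fixed \<open>w\<close>, triples of the third kind form, after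
  passing to a tripartite subsystem, a linear triangle-free hypergraph, which is \<open>(6,
  3)\<close>-free.

  Lower bound on \<open>CL\<close>. The triples \<open>(x\<^sub>i, y\<^sub>j, z\<^sub>i\<^sub>+\<^sub>j)\<close> do contain triangles, but a triangle
  only obstructs the edge that shares its \<open>x\<close> and its \<open>z\<close> with the other two, and in
  lexicographic order that edge never comes last. So each triple can be used with every \<open>w\<close>.
\<close>

section \<open>Relative entropy of partitions\<close>

definition cell :: "('a \<Rightarrow> 'l) \<Rightarrow> 'a set \<Rightarrow> 'a \<Rightarrow> 'a set" where
  "cell l W v = {w \<in> W. l w = l v}"

definition log_density :: "('a \<Rightarrow> 'l) \<Rightarrow> 'a set \<Rightarrow> 'a set \<Rightarrow> real" where
  "log_density l W U = (\<Sum>w\<in>W. ln (card (cell l W w) / card (cell l U w)))"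

text \<open>\<open>card W\<close> times the Kullback-Leibler divergence between the label
  distributions of a uniform point of \<open>W\<close> and of a uniform point of
  \<open>U\<close>.\<close>

definition rel_entropy :: "('a \<Rightarrow> 'l) \<Rightarrow> 'a set \<Rightarrow> 'a set \<Rightarrow> real" where
  "rel_entropy l W U = log_density l W U - card W * ln (card W / card U)"

lemma cell_card_pos:
  assumes "finite W" "w \<in> W" shows "card (cell l W w) > 0"
  using assms by (auto simp: cell_def card_gt_0_iff)

lemma log_density_nonpos:
  assumes "finite U" "W \<subseteq> U" shows "log_density l W U \<le> 0"
  unfolding log_density_def
proof (rule sum_nonpos)
  fix w assume w: "w \<in> W"
  have fW: "finite W" using assms finite_subset by blast
  have "card (cell l W w) \<le> card (cell l U w)"
    using assms by (intro card_mono) (auto simp: cell_def)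
  moreover have "card (cell l W w) > 0" by (rule cell_card_pos[OF fW w])
  ultimately show "ln (real (card (cell l W w)) / real (card (cell l U w))) \<le> 0"
    by (intro ln_le_zero_iff[THEN iffD2]) (auto simp: divide_simps)
qed

text \<open>After exchanging the sums, each \<open>v \<in> U\<close> receives
  \<open>g v / card (cell l W v)\<close> from every point of \<open>W\<close> in its cell: in total
  \<open>g v\<close>, or nothing if the cell misses \<open>W\<close>.\<close>

lemma sum_inverse_density_le:
  fixes g :: "'a \<Rightarrow> real"
  assumes U: "finite U" and WU: "W \<subseteq> U" and pos: "\<And>v. v \<in> U \<Longrightarrow> g v \<ge> 0"
    and const: "\<And>v w. v \<in> U \<Longrightarrow> w \<in> U \<Longrightarrow> l v = l w \<Longrightarrow> g v = g w"
  shows "(\<Sum>w\<in>W. g w * card (cell l U w) / card (cell l W w)) \<le> sum g U"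
proof -
  have fW: "finite W" using assms finite_subset by blast
  have "(\<Sum>w\<in>W. g w * card (cell l U w) / card (cell l W w))
      = (\<Sum>w\<in>W. \<Sum>v\<in>{v\<in>U. l v = l w}. g v / card (cell l W v))"
  proof (rule sum.cong[OF refl])
    fix w assume w: "w \<in> W"
    have "(\<Sum>v\<in>{v\<in>U. l v = l w}. g v / card (cell l W v))
        = (\<Sum>v\<in>{v\<in>U. l v = l w}. g w / card (cell l W w))"
      using w WU by (intro sum.cong) (auto simp: cell_def intro!: arg_cong2[of _ _ _ _ "(/)"] const)
    also have "\<dots> = g w * card (cell l U w) / card (cell l W w)"
      by (simp add: cell_def)
    finally show "g w * card (cell l U w) / card (cell l W w)
      = (\<Sum>v\<in>{v\<in>U. l v = l w}. g v / card (cell l W v))" by simp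
  qed
  also have "\<dots> = (\<Sum>v\<in>U. \<Sum>w\<in>{w\<in>W. l v = l w}. g v / card (cell l W v))"
    using fW U by (rule sum.swap_restrict)
  also have "\<dots> = (\<Sum>v\<in>U. g v * (card (cell l W v) / card (cell l W v)))"
  proof (intro sum.cong refl)
    fix v
    have "{w\<in>W. l v = l w} = cell l W v" by (auto simp: cell_def)
    then show "(\<Sum>w | w \<in> W \<and> l v = l w. g v / card (cell l W v))
        = g v * (card (cell l W v) / card (cell l W v))" by simp
  qed
  also have "\<dots> \<le> sum g U"
    using pos by (intro sum_mono) (auto intro: mult_left_le)
  finally show ?thesis .
qed

text \<open>Markov's inequality: a counted point contributes at least 1 to \<open>\<delta>\<close>
  times the sum of inverse densities, which is at most \<open>\<delta> * card A\<close>.\<close>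

lemma card_low_density:
  fixes \<delta> :: real
  assumes A: "finite A" and XA: "X \<subseteq> A" and \<delta>: "\<delta> \<ge> 0"
  shows "card {x\<in>X. card (cell l X x) < \<delta> * card (cell l A x)} \<le> \<delta> * card A"
proof -
  have fX: "finite X" using A XA finite_subset by blast
  let ?bad = "{x\<in>X. card (cell l X x) < \<delta> * card (cell l A x)}"
  have "real (card ?bad) = (\<Sum>x\<in>?bad. 1)" by simp
  also have "\<dots> \<le> (\<Sum>x\<in>?bad. \<delta> * (card (cell l A x) / card (cell l X x)))"
  proof (rule sum_mono)
    fix x assume "x \<in> ?bad"
    moreover from this have "card (cell l X x) > 0" using fX by (auto intro: cell_card_pos)
    ultimately show "1 \<le> \<delta> * (card (cell l A x) / card (cell l X x))" by (simp add: field_simps)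
  qed
  also have "\<dots> \<le> (\<Sum>x\<in>X. \<delta> * (card (cell l A x) / card (cell l X x)))"
    using fX \<delta> by (intro sum_mono2) auto
  also have "\<dots> = \<delta> * (\<Sum>x\<in>X. card (cell l A x) / card (cell l X x))"
    by (simp add: sum_distrib_left)
  also have "\<dots> \<le> \<delta> * sum (\<lambda>_. 1) A"
    using \<delta> sum_inverse_density_le[OF A XA, of "\<lambda>_. 1" l] by (intro mult_left_mono) auto
  finally show ?thesis by simp
qed

text \<open>The Donsker--Varadhan variational bound for relative entropy, from \<open>ln x \<ge> 1 - 1 / x\<close>.\<close>

lemma rel_entropy_ge:
  fixes g :: "'a \<Rightarrow> real"
  assumes U: "finite U" and WU: "W \<subseteq> U" and pos: "\<And>v. v \<in> U \<Longrightarrow> g v > 0"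
    and const: "\<And>v w. v \<in> U \<Longrightarrow> w \<in> U \<Longrightarrow> l v = l w \<Longrightarrow> g v = g w"
  shows "rel_entropy l W U \<ge> (\<Sum>w\<in>W. ln (g w)) + card W - card W / card U * sum g U"
proof -
  have fW: "finite W" using assms finite_subset by blast
  have pw: "ln (card (cell l W w) / card (cell l U w)) \<ge> ln (card W / card U) + ln (g w) + 1
      - card W / card U * (g w * card (cell l U w) / card (cell l W w))" if w: "w \<in> W" for w
  proof -
    have 1: "card (cell l W w) > 0" "card (cell l U w) > 0" "card W > 0" "card U > 0" "g w > 0"
      using w WU cell_card_pos[OF fW w] cell_card_pos[OF U, of w] fW U pos by (auto simp: card_gt_0_iff)
    define x where "x = (card (cell l W w) / card (cell l U w)) / (card W / card U * g w)"
    have x: "x > 0" unfolding x_def using 1 by auto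
    have "ln (1 / x) \<le> 1 / x - 1" using x by (intro ln_le_minus_one) auto
    then have "ln x \<ge> 1 - 1 / x" using x by (simp add: ln_div)
    moreover have "ln x = ln (card (cell l W w) / card (cell l U w)) - (ln (card W / card U) + ln (g w))"
      unfolding x_def using 1 by (simp add: ln_div ln_mult)
    moreover have "1 / x = card W / card U * (g w * card (cell l U w) / card (cell l W w))"
      unfolding x_def by (simp add: ac_simps)
    ultimately show ?thesis by linarith
  qed
  have "log_density l W U \<ge> (\<Sum>w\<in>W. ln (card W / card U) + ln (g w) + 1
      - card W / card U * (g w * card (cell l U w) / card (cell l W w)))"
    unfolding log_density_def using pw by (intro sum_mono)
  also have "(\<Sum>w\<in>W. ln (card W / card U) + ln (g w) + 1
      - card W / card U * (g w * card (cell l U w) / card (cell l W w)))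
    = card W * ln (card W / card U) + (\<Sum>w\<in>W. ln (g w)) + card W
      - card W / card U * (\<Sum>w\<in>W. g w * card (cell l U w) / card (cell l W w))"
    by (simp add: sum.distrib sum_subtractf sum_distrib_left)
  finally have "log_density l W U \<ge> card W * ln (card W / card U) + (\<Sum>w\<in>W. ln (g w)) + card W
      - card W / card U * (\<Sum>w\<in>W. g w * card (cell l U w) / card (cell l W w))" .
  moreover have "card W / card U * (\<Sum>w\<in>W. g w * card (cell l U w) / card (cell l W w))
      \<le> card W / card U * sum g U"
  proof (rule mult_left_mono)
    show "(\<Sum>w\<in>W. g w * card (cell l U w) / card (cell l W w)) \<le> sum g U"
      by (rule sum_inverse_density_le[OF U WU]) (fact less_imp_le[OF pos], fact const)
  qed simp
  ultimately show ?thesis unfolding rel_entropy_def by linarith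
qed

lemma rel_entropy_nonneg:
  assumes "finite U" "W \<subseteq> U" shows "rel_entropy l W U \<ge> 0"
proof (cases "U = {}")
  case True
  then show ?thesis using assms by (simp add: rel_entropy_def log_density_def)
next
  case False
  then show ?thesis
    using rel_entropy_ge[OF assms, of "\<lambda>_. 1" l] assms(1) by simp
qed

text \<open>The bound \<open>rel_entropy_ge\<close> with weight 1/2 on \<open>S\<close> and 3/2 off
  it. As \<open>S\<close> fills half of \<open>U\<close>, the average weight on \<open>U\<close> is
  at most 1, while each point of \<open>W\<close> outside \<open>S\<close> gains
  \<open>ln (3/2)\<close>. Useful when \<open>W\<close> mostly avoids \<open>S\<close>.\<close>

lemma rel_entropy_ge_half:
  assumes U: "finite U" and WU: "W \<subseteq> U"
    and union: "\<And>v w. v \<in> U \<Longrightarrow> w \<in> U \<Longrightarrow> l v = l w \<Longrightarrow> v \<in> S \<longleftrightarrow> w \<in> S"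
    and half: "2 * card (U \<inter> S) \<ge> card U"
  shows "rel_entropy l W U \<ge> card W / 3 - 2 * card (W \<inter> S)"
proof (cases "U = {}")
  case True
  then show ?thesis using assms by (simp add: rel_entropy_def log_density_def)
next
  case False
  then have U0: "card U > 0" using U by auto
  have fW: "finite W" using assms finite_subset by blast
  define g :: "'a \<Rightarrow> real" where "g v = (if v \<in> S then 1/2 else 3/2)" for v
  have sumg: "sum h X = card (X \<inter> S) * a + card (X - S) * b"
    if "finite X" "\<And>v. h v = (if v \<in> S then a else b)" for X and h :: "'a \<Rightarrow> real" and a b :: real
    using that by (simp add: sum.If_cases Diff_eq Collect_neg_eq)
  have card_split: "card X = card (X \<inter> S) + card (X - S)" if "finite X" for X
    using that by (rule card_Int_Diff)
  have "sum g U = card (U \<inter> S) * (1/2) + card (U - S) * (3/2)"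
    by (rule sumg[OF U]) (simp add: g_def)
  then have "sum g U \<le> card U" using half card_split[OF U] by simp
  then have "card W / card U * sum g U \<le> card W / card U * card U"
    by (intro mult_left_mono) auto
  then have 1: "card W / card U * sum g U \<le> card W" using U0 by simp
  have "(\<Sum>w\<in>W. ln (g w)) = card (W \<inter> S) * ln (1/2) + card (W - S) * ln (3/2)"
    by (rule sumg[OF fW]) (simp add: g_def)
  moreover have "ln (1/2::real) \<ge> -1" "ln (3/2::real) \<ge> 1/3"
    using ln_le_minus_one[of "2::real"] ln_le_minus_one[of "2/3::real"] by (simp_all add: ln_div)
  then have "real (card (W \<inter> S)) * ln (1/2) \<ge> real (card (W \<inter> S)) * (-1)"
    "real (card (W - S)) * ln (3/2) \<ge> real (card (W - S)) * (1/3)"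
    by (auto simp only: intro!: mult_left_mono of_nat_0_le_iff)
  ultimately have "(\<Sum>w\<in>W. ln (g w)) \<ge> card (W - S) / 3 - card (W \<inter> S)" by linarith
  moreover have "real (card W) = card (W \<inter> S) + card (W - S)" using card_split[OF fW] by linarith
  \<comment> \<open>Eliminating \<open>card (W - S)\<close> gives \<open>card (W \<inter> S)\<close>
    the coefficient 4/3, rounded up to 2.\<close>
  ultimately have 2: "(\<Sum>w\<in>W. ln (g w)) \<ge> card W / 3 - 2 * card (W \<inter> S)"
    by (simp add: field_simps)
  have "rel_entropy l W U \<ge> (\<Sum>w\<in>W. ln (g w)) + card W - card W / card U * sum g U"
  proof (rule rel_entropy_ge[OF U WU])
    show "g v > 0" for v by (simp add: g_def)
    show "g v = g w" if "v \<in> U" "w \<in> U" "l v = l w" for v w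
      using union[OF that] by (simp add: g_def)
  qed
  with 1 2 show ?thesis by linarith
qed

text \<open>Chain rule: inside one cell of \<open>l\<close> the old density is constant, namely that
  of the trivial partition of the cell, so refining adds the relative entropy of \<open>l'\<close>
  within the cell.\<close>

lemma log_density_refine:
  assumes fW: "finite W" and WU: "W \<subseteq> U"
    and ref: "\<And>v w. v \<in> U \<Longrightarrow> w \<in> U \<Longrightarrow> l' v = l' w \<Longrightarrow> l v = l w"
  shows "log_density l' W U - log_density l W U
    = (\<Sum>i\<in>l ` W. rel_entropy l' {w\<in>W. l w = i} {u\<in>U. l u = i})"
proof -
  have "rel_entropy l' {w\<in>W. l w = i} {u\<in>U. l u = i}
      = (\<Sum>w\<in>{w\<in>W. l w = i}. ln (card (cell l' W w) / card (cell l' U w)))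
        - (\<Sum>w\<in>{w\<in>W. l w = i}. ln (card (cell l W w) / card (cell l U w)))" for i
  proof -
    have c1: "cell l' {w\<in>W. l w = i} w = cell l' W w" "cell l' {u\<in>U. l u = i} w = cell l' U w"
      if "w \<in> {w\<in>W. l w = i}" for w
      using that WU unfolding cell_def by (auto dest: ref)
    have c2: "cell l W w = {w\<in>W. l w = i}" "cell l U w = {u\<in>U. l u = i}"
      if "w \<in> {w\<in>W. l w = i}" for w
      using that unfolding cell_def by auto
    show ?thesis
      unfolding rel_entropy_def log_density_def by (simp add: c1 c2)
  qed
  then show ?thesis
    unfolding log_density_def
    by (simp add: sum_subtractf flip: sum.image_gen[OF fW, of _ l])
qed

text \<open>Densities of product cells multiply, so their logarithms add. This traces an uneven
  rectangle back to its two sides.\<close>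

lemma rel_entropy_Times:
  assumes "finite A" "finite B" "X \<subseteq> A" "Y \<subseteq> B"
  shows "rel_entropy (\<lambda>(a, b). (l a, l' b)) (X \<times> Y) (A \<times> B)
    = card Y * rel_entropy l X A + card X * rel_entropy l' Y B"
proof (cases "X = {} \<or> Y = {}")
  case True
  then show ?thesis by (auto simp: rel_entropy_def log_density_def)
next
  case False
  have f: "finite X" "finite Y" using assms finite_subset by auto
  have c: "cell (\<lambda>(a, b). (l a, l' b)) (V \<times> W) (x, y) = cell l V x \<times> cell l' W y" for V W x y
    by (auto simp: cell_def)
  have "log_density (\<lambda>(a, b). (l a, l' b)) (X \<times> Y) (A \<times> B)
     = (\<Sum>x\<in>X. \<Sum>y\<in>Y. ln (card (cell l X x) / card (cell l A x))
          + ln (card (cell l' Y y) / card (cell l' B y)))"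
    unfolding log_density_def sum.cartesian_product
  proof (rule sum.cong[OF refl], clarify)
    fix x y assume xy: "x \<in> X" "y \<in> Y"
    have "card (cell l X x) > 0" "card (cell l A x) > 0" "card (cell l' Y y) > 0" "card (cell l' B y) > 0"
      using xy assms f by (auto intro!: cell_card_pos)
    then show "ln (real (card (cell (\<lambda>(a, b). (l a, l' b)) (X \<times> Y) (x, y))) /
           real (card (cell (\<lambda>(a, b). (l a, l' b)) (A \<times> B) (x, y)))) =
       ln (card (cell l X x) / card (cell l A x)) + ln (card (cell l' Y y) / card (cell l' B y))"
      unfolding c card_cartesian_product by (simp add: ln_mult ln_div)
  qed
  also have "\<dots> = card Y * log_density l X A + card X * log_density l' Y B"
    unfolding log_density_def by (simp add: sum.distrib sum_distrib_left)
  finally have 1: "log_density (\<lambda>(a, b). (l a, l' b)) (X \<times> Y) (A \<times> B)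
     = card Y * log_density l X A + card X * log_density l' Y B" .
  have "card X > 0" "card Y > 0" "card A > 0" "card B > 0"
    using False assms f by (auto simp: card_gt_0_iff)
  then show ?thesis
    unfolding rel_entropy_def 1 card_cartesian_product by (simp add: ln_mult ln_div algebra_simps)
qed

text \<open>A greedy choice: each index that still covers a new proportion \<open>\<theta> \<cdot> d\<close> of \<open>U\<close> is taken.\<close>

lemma greedy_cover:
  fixes R :: "'c \<Rightarrow> 'a set" and \<theta> d :: real
  assumes C: "finite C" and U: "finite U" "U \<noteq> {}" and RU: "\<And>c. c \<in> C \<Longrightarrow> R c \<subseteq> U"
    and big: "\<And>c. c \<in> C \<Longrightarrow> card (R c) \<ge> d * card U" and pos: "\<theta> > 0" "d > 0"
  obtains K where "K \<subseteq> C" "card K \<le> 1 / (\<theta> * d)"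
    "\<And>c. c \<in> C \<Longrightarrow> card (R c - \<Union> (R ` K)) \<le> \<theta> * card (R c)"
proof -
  \<comment> \<open>A maximal member of this family replaces the greedy run: any further
    \<open>c\<close> would cover fewer than \<open>\<theta> * d * card U\<close> new points.\<close>
  define \<K> where "\<K> = {K. K \<subseteq> C \<and> card (\<Union> (R ` K)) \<ge> card K * (\<theta> * d) * card U}"
  have "finite \<K>" "{} \<in> \<K>" using C by (auto simp: \<K>_def)
  then obtain K where K: "K \<in> \<K>" and max: "\<And>K'. K' \<in> \<K> \<Longrightarrow> K \<subseteq> K' \<Longrightarrow> K' = K"
    using finite_has_maximal2[of \<K> "{}"] by metis
  have KC: "K \<subseteq> C" and Kc: "card (\<Union> (R ` K)) \<ge> card K * (\<theta> * d) * card U"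
    using K by (auto simp: \<K>_def)
  have fK: "finite K" using KC C finite_subset by blast
  have U0: "card U > 0" using U by auto
  have UN: "\<Union> (R ` K) \<subseteq> U" using RU KC by blast
  have "card K * (\<theta> * d) * card U \<le> 1 * real (card U)"
    using Kc card_mono[OF U(1) UN] by simp
  then have "card K * (\<theta> * d) \<le> 1" using U0 by (metis mult_le_cancel_right_pos of_nat_0_less_iff of_nat_mult of_nat_1)
  then have "card K \<le> 1 / (\<theta> * d)" using pos by (simp add: field_simps)
  moreover have "card (R c - \<Union> (R ` K)) \<le> \<theta> * card (R c)" if c: "c \<in> C" for c
  proof (cases "c \<in> K")
    case True
    then have "R c - \<Union> (R ` K) = {}" by blast
    then show ?thesis using pos by (simp only: card.empty) simp
  next
    case False
    then have "insert c K \<notin> \<K>" using max by blast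
    then have "card (\<Union> (R ` insert c K)) < card (insert c K) * (\<theta> * d) * card U"
      using c KC by (auto simp: \<K>_def)
    also have "card (insert c K) = card K + 1" using False fK by simp
    also have "\<Union> (R ` insert c K) = \<Union> (R ` K) \<union> (R c - \<Union> (R ` K))" by auto
    also have "card \<dots> = card (\<Union> (R ` K)) + card (R c - \<Union> (R ` K))"
      using UN RU[OF c] U by (intro card_Un_disjoint) (auto intro: finite_subset)
    finally have "card (R c - \<Union> (R ` K)) \<le> \<theta> * (d * card U)"
      using Kc by (simp add: algebra_simps)
    also have "\<dots> \<le> \<theta> * card (R c)" using big[OF c] pos by (intro mult_left_mono) auto
    finally show ?thesis .
  qed
  ultimately show ?thesis using KC that by blast
qed

section \<open>Unions of induced matchings\<close>

text \<open>The Ruzsa-Szemeredi setting. For fixed \<open>c\<close>, \<open>unique_a\<close> and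
  \<open>unique_b\<close> make the pairs a matching and \<open>induced\<close> makes it an induced
  one; with \<open>a' = a\<close> and \<open>b' = b\<close> it also says that no pair belongs to two
  indices.\<close>

locale rs_system =
  fixes A :: "'a set" and B :: "'b set" and C :: "'c set" and T :: "('a \<times> 'b \<times> 'c) set" and n :: nat
  assumes fin: "finite A" "finite B" "finite C"
    and cards: "card A = n" "card B = n" "card C = n"
    and T_sub: "T \<subseteq> A \<times> B \<times> C"
    and unique_a: "(a, b, c) \<in> T \<Longrightarrow> (a', b, c) \<in> T \<Longrightarrow> a' = a"
    and unique_b: "(a, b, c) \<in> T \<Longrightarrow> (a, b', c) \<in> T \<Longrightarrow> b' = b"
    and induced: "(a, b', c) \<in> T \<Longrightarrow> (a', b, c) \<in> T \<Longrightarrow> (a, b, c') \<in> T \<Longrightarrow> c' = c"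
begin

definition nbA :: "'c \<Rightarrow> 'a set" where "nbA c = {a. \<exists>b. (a, b, c) \<in> T}"
definition nbB :: "'c \<Rightarrow> 'b set" where "nbB c = {b. \<exists>a. (a, b, c) \<in> T}"
definition G :: "('a \<times> 'b) set" where "G = {(a, b). \<exists>c. (a, b, c) \<in> T}"

definition labA :: "'c set \<Rightarrow> 'a \<Rightarrow> 'c set" where "labA F a = {c\<in>F. a \<in> nbA c}"
definition labB :: "'c set \<Rightarrow> 'b \<Rightarrow> 'c set" where "labB F b = {c\<in>F. b \<in> nbB c}"
definition labAB :: "'c set \<Rightarrow> 'a \<times> 'b \<Rightarrow> 'c set \<times> 'c set" where
  "labAB F = (\<lambda>(a, b). (labA F a, labB F b))"

text \<open>The two sums over \<open>C\<close> serve the pairs of parts that the chosen rectangles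
  fill by less than half: there the gain comes from the sets \<open>nbA c\<close> and
  \<open>nbB c\<close> instead of \<open>G\<close>.\<close>

definition potential :: "'c set \<Rightarrow> real" where
  "potential F = log_density (labAB F) G (A \<times> B)
     + (\<Sum>c\<in>C. log_density (labA F) (nbA c) A) + (\<Sum>c\<in>C. log_density (labB F) (nbB c) B)"

lemma nbA_sub: "nbA c \<subseteq> A" and nbB_sub: "nbB c \<subseteq> B" and G_sub: "G \<subseteq> A \<times> B"
  using T_sub by (auto simp: nbA_def nbB_def G_def)

lemma fin_T: "finite T"
  using fin T_sub by (meson finite_SigmaI finite_subset)

lemma fin_nb: "finite (nbA c)" "finite (nbB c)" and fin_G: "finite G"
  using fin by (auto intro: finite_subset[OF nbA_sub] finite_subset[OF nbB_sub] finite_subset[OF G_sub])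

lemma T_CD: "(a, b, c) \<in> T \<Longrightarrow> c \<in> C"
  using T_sub by auto

text \<open>An index \<open>c\<close> and a vertex \<open>a\<close> determine the triple, so
  \<open>T\<close> is in bijection with the incidences \<open>(c, a)\<close>.\<close>

lemma sum_T_A: "(\<Sum>(a, b, c)\<in>T. f a c) = (\<Sum>c\<in>C. \<Sum>a\<in>nbA c. f a c)" for f :: "'a \<Rightarrow> 'c \<Rightarrow> real"
proof -
  have "(\<Sum>c\<in>C. \<Sum>a\<in>nbA c. f a c) = (\<Sum>(c, a)\<in>Sigma C nbA. f a c)"
    using fin fin_nb by (subst sum.Sigma) auto
  also have "\<dots> = (\<Sum>(a, b, c)\<in>T. f a c)"
  proof -
    have "inj_on (\<lambda>(a, b, c). (c, a)) T"
      by (auto simp: inj_on_def intro: unique_b)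
    moreover have "(\<lambda>(a, b, c). (c, a)) ` T = Sigma C nbA"
      by (force simp: nbA_def dest: T_CD)
    ultimately have "bij_betw (\<lambda>(a, b, c). (c, a)) T (Sigma C nbA)"
      by (simp add: bij_betw_def)
    from sum.reindex_bij_betw[OF this, of "\<lambda>(c, x). f x c"] show ?thesis
      by (simp add: case_prod_beta)
  qed
  finally show ?thesis by simp
qed

lemma sum_T_B: "(\<Sum>(a, b, c)\<in>T. f b c) = (\<Sum>c\<in>C. \<Sum>b\<in>nbB c. f b c)" for f :: "'b \<Rightarrow> 'c \<Rightarrow> real"
proof -
  have "(\<Sum>c\<in>C. \<Sum>b\<in>nbB c. f b c) = (\<Sum>(c, b)\<in>Sigma C nbB. f b c)"
    using fin fin_nb by (subst sum.Sigma) auto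
  also have "\<dots> = (\<Sum>(a, b, c)\<in>T. f b c)"
  proof -
    have "inj_on (\<lambda>(a, b, c). (c, b)) T"
      by (auto simp: inj_on_def intro: unique_a)
    moreover have "(\<lambda>(a, b, c). (c, b)) ` T = Sigma C nbB"
      by (force simp: nbB_def dest: T_CD)
    ultimately have "bij_betw (\<lambda>(a, b, c). (c, b)) T (Sigma C nbB)"
      by (simp add: bij_betw_def)
    from sum.reindex_bij_betw[OF this, of "\<lambda>(c, x). f x c"] show ?thesis
      by (simp add: case_prod_beta)
  qed
  finally show ?thesis by simp
qed

lemma sum_card_nbA: "(\<Sum>c\<in>C. real (card (nbA c))) = card T"
  using sum_T_A[of "\<lambda>_ _. 1"] by (simp add: case_prod_beta)

lemma sum_card_nbB: "(\<Sum>c\<in>C. real (card (nbB c))) = card T"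
  using sum_T_B[of "\<lambda>_ _. 1"] by (simp add: case_prod_beta)

lemma unique_c: "(a, b, c) \<in> T \<Longrightarrow> (a, b, c') \<in> T \<Longrightarrow> c' = c"
  by (rule induced)

lemma bij_T_G: "bij_betw (\<lambda>(a, b, c). (a, b)) T G"
  unfolding bij_betw_def inj_on_def G_def by (force dest: unique_c)

lemma card_G: "card G = card T"
  using bij_T_G by (rule bij_betw_same_card[symmetric])

lemma potential_nonpos: "potential F \<le> 0"
proof -
  have "log_density (labAB F) G (A \<times> B) \<le> 0"
    using fin G_sub by (intro log_density_nonpos) auto
  moreover have "(\<Sum>c\<in>C. log_density (labA F) (nbA c) A) \<le> 0"
    using fin nbA_sub by (intro sum_nonpos log_density_nonpos) auto
  moreover have "(\<Sum>c\<in>C. log_density (labB F) (nbB c) B) \<le> 0"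
    using fin nbB_sub by (intro sum_nonpos log_density_nonpos) auto
  ultimately show ?thesis unfolding potential_def by linarith
qed

lemma log_density_const:
  assumes "\<And>v w. l v = l w" shows "log_density l W U = card W * ln (card W / card U)"
proof -
  have "cell l V w = V" for V w using assms by (auto simp: cell_def)
  then show ?thesis by (simp add: log_density_def)
qed

text \<open>Jensen's inequality for \<open>y * ln y\<close>, by the tangent at the mean density
  \<open>x = card T / n ^ 2\<close>; the linear corrections cancel in the sum.\<close>

lemma sum_entropy_ge:
  fixes X :: "'c \<Rightarrow> 'd set"
  assumes m: "(\<Sum>c\<in>C. real (card (X c))) = card T" and n: "n > 0" and T: "T \<noteq> {}"
  shows "(\<Sum>c\<in>C. card (X c) * ln (card (X c) / n)) \<ge> card T * ln (card T / n ^ 2)"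
proof -
  define x where "x = card T / real n ^ 2"
  have x: "x > 0" using n T fin_T by (auto simp: x_def card_gt_0_iff)
  have "card (X c) * ln (card (X c) / n) \<ge> card (X c) * (ln x + 1) - x * n" for c
  proof (cases "card (X c) = 0")
    case True
    then show ?thesis using x by simp
  next
    case False
    define y where "y = card (X c) / real n"
    have y: "y > 0" using False n by (simp add: y_def)
    have "ln (x / y) \<le> x / y - 1" using x y by (intro ln_le_minus_one) auto
    then have "ln y \<ge> ln x + 1 - x / y" using x y by (simp add: ln_div)
    then have "card (X c) * ln y \<ge> card (X c) * (ln x + 1 - x / y)"
      by (intro mult_left_mono) auto
    moreover have "card (X c) * (x / y) = x * n" using False n by (simp add: y_def)
    ultimately show ?thesis by (simp add: y_def algebra_simps)
  qed
  then have "(\<Sum>c\<in>C. card (X c) * ln (card (X c) / n)) \<ge> (\<Sum>c\<in>C. card (X c) * (ln x + 1) - x * n)"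
    by (intro sum_mono)
  also have "(\<Sum>c\<in>C. card (X c) * (ln x + 1) - x * n) = card T * (ln x + 1) - n * (x * n)"
    using m cards by (simp add: sum_subtractf flip: sum_distrib_right)
  also have "n * (x * n) = card T" using n by (simp add: x_def power2_eq_square)
  finally show ?thesis by (simp add: x_def algebra_simps)
qed

lemma potential_empty:
  assumes "n > 0" "T \<noteq> {}" shows "potential {} \<ge> 3 * (card T * ln (card T / n ^ 2))"
proof -
  have "log_density (labAB {}) G (A \<times> B) = card T * ln (card T / n ^ 2)"
    by (subst log_density_const) (auto simp: labAB_def labA_def labB_def card_G cards card_cartesian_product power2_eq_square)
  moreover have "(\<Sum>c\<in>C. log_density (labA {}) (nbA c) A) \<ge> card T * ln (card T / n ^ 2)"
    using sum_entropy_ge[OF sum_card_nbA assms]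
    by (subst log_density_const) (auto simp: labA_def cards)
  moreover have "(\<Sum>c\<in>C. log_density (labB {}) (nbB c) B) \<ge> card T * ln (card T / n ^ 2)"
    using sum_entropy_ge[OF sum_card_nbB assms]
    by (subst log_density_const) (auto simp: labB_def cards)
  ultimately show ?thesis unfolding potential_def by linarith
qed

section \<open>Gain of potential under refinement\<close>

definition partA :: "'c set \<Rightarrow> 'c set \<Rightarrow> 'a set" where "partA F i = {a\<in>A. labA F a = i}"
definition partB :: "'c set \<Rightarrow> 'c set \<Rightarrow> 'b set" where "partB F j = {b\<in>B. labB F b = j}"

lemma lab_refine:
  assumes "F \<subseteq> F'"
  shows "labA F' a = labA F' a' \<Longrightarrow> labA F a = labA F a'"
    "labB F' b = labB F' b' \<Longrightarrow> labB F b = labB F b'"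
proof -
  have "labA F a = labA F' a \<inter> F" "labB F b = labB F' b \<inter> F" for a b
    using assms by (auto simp: labA_def labB_def)
  then show "labA F' a = labA F' a' \<Longrightarrow> labA F a = labA F a'"
    "labB F' b = labB F' b' \<Longrightarrow> labB F b = labB F b'" by metis+
qed

text \<open>By \<open>induced\<close>, an edge of \<open>G\<close> inside the rectangle belongs to
  the matching of \<open>c\<close>, and a matching has at most \<open>n\<close> edges.\<close>

lemma card_rect: "card (G \<inter> nbA c \<times> nbB c) \<le> n"
proof -
  have "G \<inter> nbA c \<times> nbB c \<subseteq> {(a, b). (a, b, c) \<in> T}"
    unfolding G_def nbA_def nbB_def by (auto dest: induced)
  moreover have "inj_on fst {(a, b). (a, b, c) \<in> T}"
    by (auto simp: inj_on_def dest: unique_b)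
  then have "inj_on fst (G \<inter> nbA c \<times> nbB c)"
    using calculation by (rule inj_on_subset)
  moreover have "fst ` (G \<inter> nbA c \<times> nbB c) \<subseteq> A" using nbA_sub[of c] by auto
  ultimately show ?thesis using fin cards card_inj_on_le by metis
qed

text \<open>Averages over a part, so that summing over \<open>T\<close> gives the total gain.  When the intersection in the
  denominator is empty, the numerator is \<open>0\<close> as well.\<close>

definition gainA :: "'c set \<Rightarrow> 'c set \<Rightarrow> 'c \<Rightarrow> 'c set \<Rightarrow> real" where
  "gainA F F' c i = rel_entropy (labA F') (nbA c \<inter> partA F i) (partA F i) / card (nbA c \<inter> partA F i)"
definition gainB :: "'c set \<Rightarrow> 'c set \<Rightarrow> 'c \<Rightarrow> 'c set \<Rightarrow> real" where
  "gainB F F' c j = rel_entropy (labB F') (nbB c \<inter> partB F j) (partB F j) / card (nbB c \<inter> partB F j)"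

lemma gain_nonneg: "gainA F F' c i \<ge> 0" "gainB F F' c j \<ge> 0"
  unfolding gainA_def gainB_def using fin
  by (auto intro!: divide_nonneg_nonneg rel_entropy_nonneg simp: partA_def partB_def)

lemma potential_gainA:
  assumes "F \<subseteq> F'"
  shows "log_density (labA F') (nbA c) A - log_density (labA F) (nbA c) A
     = (\<Sum>a\<in>nbA c. gainA F F' c (labA F a))"
proof -
  have "log_density (labA F') (nbA c) A - log_density (labA F) (nbA c) A
     = (\<Sum>i\<in>labA F ` nbA c. rel_entropy (labA F') {a\<in>nbA c. labA F a = i} {a\<in>A. labA F a = i})"
    by (rule log_density_refine[OF fin_nb(1) nbA_sub lab_refine(1)[OF assms]])
  also have "\<dots> = (\<Sum>i\<in>labA F ` nbA c. \<Sum>a | a \<in> nbA c \<and> labA F a = i. gainA F F' c (labA F a))"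
  proof (rule sum.cong[OF refl])
    fix i assume i: "i \<in> labA F ` nbA c"
    have eq: "nbA c \<inter> partA F i = {a\<in>nbA c. labA F a = i}" using nbA_sub by (auto simp: partA_def)
    have "card {a\<in>nbA c. labA F a = i} > 0" using i fin_nb by (auto simp: card_gt_0_iff)
    then have "(\<Sum>a | a \<in> nbA c \<and> labA F a = i. gainA F F' c i)
        = rel_entropy (labA F') {a\<in>nbA c. labA F a = i} (partA F i)"
      by (simp add: gainA_def eq)
    then show "rel_entropy (labA F') {a\<in>nbA c. labA F a = i} {a\<in>A. labA F a = i}
      = (\<Sum>a | a \<in> nbA c \<and> labA F a = i. gainA F F' c (labA F a))"
      by (simp add: partA_def)
  qed
  also have "\<dots> = (\<Sum>a\<in>nbA c. gainA F F' c (labA F a))"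
    by (rule sum.image_gen[OF fin_nb(1), symmetric])
  finally show ?thesis .
qed

lemma potential_gainB:
  assumes "F \<subseteq> F'"
  shows "log_density (labB F') (nbB c) B - log_density (labB F) (nbB c) B
     = (\<Sum>b\<in>nbB c. gainB F F' c (labB F b))"
proof -
  have "log_density (labB F') (nbB c) B - log_density (labB F) (nbB c) B
     = (\<Sum>i\<in>labB F ` nbB c. rel_entropy (labB F') {a\<in>nbB c. labB F a = i} {a\<in>B. labB F a = i})"
    by (rule log_density_refine[OF fin_nb(2) nbB_sub lab_refine(2)[OF assms]])
  also have "\<dots> = (\<Sum>i\<in>labB F ` nbB c. \<Sum>a | a \<in> nbB c \<and> labB F a = i. gainB F F' c (labB F a))"
  proof (rule sum.cong[OF refl])
    fix i assume i: "i \<in> labB F ` nbB c"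
    have eq: "nbB c \<inter> partB F i = {a\<in>nbB c. labB F a = i}" using nbB_sub by (auto simp: partB_def)
    have "card {a\<in>nbB c. labB F a = i} > 0" using i fin_nb by (auto simp: card_gt_0_iff)
    then have "(\<Sum>a | a \<in> nbB c \<and> labB F a = i. gainB F F' c i)
        = rel_entropy (labB F') {a\<in>nbB c. labB F a = i} (partB F i)"
      by (simp add: gainB_def eq)
    then show "rel_entropy (labB F') {a\<in>nbB c. labB F a = i} {a\<in>B. labB F a = i}
      = (\<Sum>a | a \<in> nbB c \<and> labB F a = i. gainB F F' c (labB F a))"
      by (simp add: partB_def)
  qed
  also have "\<dots> = (\<Sum>a\<in>nbB c. gainB F F' c (labB F a))"
    by (rule sum.image_gen[OF fin_nb(2), symmetric])
  finally show ?thesis .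
qed

text \<open>The chain rule for all three terms. The vertex terms are collected over
  \<open>T\<close>, to be combined triple by triple with the edge term.\<close>

lemma potential_diff:
  assumes "F \<subseteq> F'"
  shows "potential F' - potential F
    = (\<Sum>ij\<in>labAB F ` G. rel_entropy (labAB F') {e\<in>G. labAB F e = ij} (partA F (fst ij) \<times> partB F (snd ij)))
      + (\<Sum>(a, b, c)\<in>T. gainA F F' c (labA F a) + gainB F F' c (labB F b))"
proof -
  have "log_density (labAB F') G (A \<times> B) - log_density (labAB F) G (A \<times> B)
    = (\<Sum>ij\<in>labAB F ` G. rel_entropy (labAB F') {e\<in>G. labAB F e = ij} {e\<in>A \<times> B. labAB F e = ij})"
    by (rule log_density_refine[OF fin_G G_sub])
      (auto simp: labAB_def dest: lab_refine[OF assms])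
  moreover have "{e\<in>A \<times> B. labAB F e = ij} = partA F (fst ij) \<times> partB F (snd ij)" for ij
    by (auto simp: labAB_def partA_def partB_def)
  moreover have "(\<Sum>c\<in>C. log_density (labA F') (nbA c) A) - (\<Sum>c\<in>C. log_density (labA F) (nbA c) A)
      = (\<Sum>(a, b, c)\<in>T. gainA F F' c (labA F a))"
    unfolding sum_T_A[of "\<lambda>a c. gainA F F' c (labA F a)"]
    by (simp add: potential_gainA[OF assms] flip: sum_subtractf)
  moreover have "(\<Sum>c\<in>C. log_density (labB F') (nbB c) B) - (\<Sum>c\<in>C. log_density (labB F) (nbB c) B)
      = (\<Sum>(a, b, c)\<in>T. gainB F F' c (labB F b))"
    unfolding sum_T_B[of "\<lambda>a c. gainB F F' c (labB F a)"]
    by (simp add: potential_gainB[OF assms] flip: sum_subtractf)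
  ultimately show ?thesis
    unfolding potential_def by (simp add: sum.distrib case_prod_beta)
qed

end

text \<open>Bounds the number of indices after \<open>t\<close> refinements: \<open>m\<close>
  indices give at most \<open>2 ^ m\<close> parts on each side, hence \<open>4 ^ m\<close> pairs of
  parts, each of which adds at most \<open>K\<close> indices.\<close>

fun label_bound :: "nat \<Rightarrow> nat \<Rightarrow> nat" where
  "label_bound K 0 = 0"
| "label_bound K (Suc t) = label_bound K t + 4 ^ label_bound K t * K"

section \<open>One refinement step and its iteration\<close>

context rs_system
begin

text \<open>\<open>card_low_density\<close> for each of the \<open>n\<close> indices. It shows that
  few triples have a side too thin for \<open>eligible\<close>.\<close>

lemma card_lowA:
  fixes \<delta> :: real
  assumes "\<delta> \<ge> 0"
  shows "(\<Sum>(a, b, c)\<in>T. of_bool (card (nbA c \<inter> partA F (labA F a)) < \<delta> * card (partA F (labA F a))))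
     \<le> n * (\<delta> * n)"
proof -
  have eq: "nbA c \<inter> partA F (labA F a) = cell (labA F) (nbA c) a"
    "partA F (labA F a) = cell (labA F) A a" for a c
    using nbA_sub[of c] by (auto simp: cell_def partA_def)
  have "(\<Sum>(a, b, c)\<in>T. of_bool (card (nbA c \<inter> partA F (labA F a)) < \<delta> * card (partA F (labA F a))))
    = (\<Sum>c\<in>C. \<Sum>a\<in>nbA c. of_bool (card (cell (labA F) (nbA c) a) < \<delta> * card (cell (labA F) A a)) :: real)"
    unfolding eq(1) unfolding eq(2)
    by (rule sum_T_A[of "\<lambda>a c. of_bool (card (cell (labA F) (nbA c) a) < \<delta> * card (cell (labA F) A a))"])
  also have "\<dots> \<le> (\<Sum>c\<in>C. \<delta> * n)"
  proof (rule sum_mono)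
    fix c
    show "(\<Sum>a\<in>nbA c. of_bool (card (cell (labA F) (nbA c) a) < \<delta> * card (cell (labA F) A a))) \<le> \<delta> * n"
      using card_low_density[OF fin(1) nbA_sub assms, where l = "labA F", of c] fin_nb(1)[of c] cards
      by (simp add: sum.If_cases of_bool_def Int_def)
  qed
  finally show ?thesis using cards by simp
qed

lemma card_lowB:
  fixes \<delta> :: real
  assumes "\<delta> \<ge> 0"
  shows "(\<Sum>(a, b, c)\<in>T. of_bool (card (nbB c \<inter> partB F (labB F b)) < \<delta> * card (partB F (labB F b))))
     \<le> n * (\<delta> * n)"
proof -
  have eq: "nbB c \<inter> partB F (labB F a) = cell (labB F) (nbB c) a"
    "partB F (labB F a) = cell (labB F) B a" for a c
    using nbB_sub[of c] by (auto simp: cell_def partB_def)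
  have "(\<Sum>(a, b, c)\<in>T. of_bool (card (nbB c \<inter> partB F (labB F b)) < \<delta> * card (partB F (labB F b))))
    = (\<Sum>c\<in>C. \<Sum>a\<in>nbB c. of_bool (card (cell (labB F) (nbB c) a) < \<delta> * card (cell (labB F) B a)) :: real)"
    unfolding eq(1) unfolding eq(2)
    by (rule sum_T_B[of "\<lambda>a c. of_bool (card (cell (labB F) (nbB c) a) < \<delta> * card (cell (labB F) B a))"])
  also have "\<dots> \<le> (\<Sum>c\<in>C. \<delta> * n)"
  proof (rule sum_mono)
    fix c
    show "(\<Sum>a\<in>nbB c. of_bool (card (cell (labB F) (nbB c) a) < \<delta> * card (cell (labB F) B a))) \<le> \<delta> * n"
      using card_low_density[OF fin(2) nbB_sub assms, where l = "labB F", of c] fin_nb(2)[of c] cards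
      by (simp add: sum.If_cases of_bool_def Int_def)
  qed
  finally show ?thesis using cards by simp
qed

definition rect :: "'c set \<Rightarrow> 'c set \<times> 'c set \<Rightarrow> 'c \<Rightarrow> ('a \<times> 'b) set" where
  "rect F = (\<lambda>(i, j) c. (nbA c \<inter> partA F i) \<times> (nbB c \<inter> partB F j))"

text \<open>With density at least \<open>\<delta>\<close> on both sides the rectangle fills a
  proportion \<open>\<delta> ^ 2\<close> of the pair of parts, as \<open>greedy_cover\<close>
  requires.\<close>

definition eligible :: "real \<Rightarrow> 'c set \<Rightarrow> 'c set \<times> 'c set \<Rightarrow> 'c set" where
  "eligible \<delta> F = (\<lambda>(i, j). {c\<in>C. real (card (nbA c \<inter> partA F i)) \<ge> \<delta> * real (card (partA F i))
     \<and> real (card (nbB c \<inter> partB F j)) \<ge> \<delta> * real (card (partB F j))})"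

lemma fin_part: "finite (partA F i)" "finite (partB F j)"
  using fin by (auto simp: partA_def partB_def)

text \<open>\<open>greedy_cover\<close> with \<open>\<theta> = 1/100\<close> and
  \<open>d = \<delta> ^ 2\<close>, whence the bound \<open>100 / \<delta> ^ 2\<close>.\<close>

lemma cover_rects:
  fixes \<delta> :: real and K :: nat
  assumes \<delta>: "\<delta> > 0" and K: "K \<ge> 100 / \<delta> ^ 2"
  obtains Q where "Q \<subseteq> C" "card Q \<le> K"
    "\<And>c. c \<in> eligible \<delta> F ij \<Longrightarrow> card (rect F ij c - \<Union> (rect F ij ` Q)) \<le> 1/100 * card (rect F ij c)"
proof -
  obtain i j where ij: "ij = (i, j)" by fastforce
  let ?U = "partA F i \<times> partB F j"
  show ?thesis
  proof (cases "?U = {}")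
    case True
    then have "rect F ij c = {}" for c by (auto simp: rect_def ij)
    then show ?thesis using that[of "{}"] K \<delta> by simp
  next
    case False
    have big: "card (rect F ij c) \<ge> \<delta> ^ 2 * card ?U" if "c \<in> eligible \<delta> F ij" for c
    proof -
      have "\<delta> * card (partA F i) * (\<delta> * card (partB F j))
          \<le> real (card (nbA c \<inter> partA F i)) * card (nbB c \<inter> partB F j)"
        using that \<delta> by (intro mult_mono) (auto simp: eligible_def ij)
      then show ?thesis
        by (simp add: rect_def ij card_cartesian_product power2_eq_square mult_ac)
    qed
    have "finite (eligible \<delta> F ij)" using fin by (simp add: eligible_def ij)
    then obtain Q where Q: "Q \<subseteq> eligible \<delta> F ij" "card Q \<le> 1 / (1/100 * \<delta> ^ 2)"
      "\<And>c. c \<in> eligible \<delta> F ij \<Longrightarrow> card (rect F ij c - \<Union> (rect F ij ` Q)) \<le> 1/100 * card (rect F ij c)"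
      using False \<delta> fin_part big
      by (elim greedy_cover[where U = ?U and R = "rect F ij" and \<theta> = "1/100" and d = "\<delta> ^ 2"])
        (auto simp: rect_def ij)
    have "Q \<subseteq> C" using Q(1) by (auto simp: eligible_def ij)
    moreover have "card Q \<le> K" using Q(2) K by simp
    ultimately show ?thesis using Q(3) that by blast
  qed
qed

lemma labAB_mem: "labAB F e \<in> Pow F \<times> Pow F"
  by (auto simp: labAB_def labA_def labB_def split: prod.split)

text \<open>\<open>F'\<close> adds at most \<open>K\<close> covering indices for every pair of
  parts. A heavy pair gains from the edges of \<open>G\<close>, which mostly avoid the cover
  \<open>S\<close>; a light pair gains from the eligible rectangles, which lie mostly in
  \<open>S\<close>. By \<open>large\<close> the edges inside the covers are negligible.\<close>

lemma potential_step:
  fixes \<epsilon> :: real and K :: nat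
  assumes F: "F \<subseteq> C" and \<epsilon>: "0 < \<epsilon>" "\<epsilon> * n ^ 2 \<le> card T" and K: "K \<ge> 10 ^ 6 / \<epsilon> ^ 2"
    and large: "100 * (4 ^ card F * K * n) \<le> card T"
  obtains F' where "F' \<subseteq> C" "card F' \<le> card F + 4 ^ card F * K"
    "potential F' \<ge> potential F + card T / 4"
proof -
  \<comment> \<open>Small enough that for each side at most \<open>card T / 100\<close> triples are
    thin; \<open>100 / \<delta> ^ 2\<close> is then \<open>10 ^ 6 / \<epsilon> ^ 2\<close>.\<close>
  define \<delta> where "\<delta> = \<epsilon> / 100"
  have \<delta>: "\<delta> > 0" using \<epsilon> by (simp add: \<delta>_def)
  have K': "K \<ge> 100 / \<delta> ^ 2" using K \<epsilon> by (simp add: \<delta>_def field_simps)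
  have fF: "finite F" using F fin finite_subset by blast
  have "\<forall>ij. \<exists>Q. Q \<subseteq> C \<and> card Q \<le> K \<and> (\<forall>c\<in>eligible \<delta> F ij.
      card (rect F ij c - \<Union> (rect F ij ` Q)) \<le> 1/100 * card (rect F ij c))"
    using cover_rects[OF \<delta> K'] by metis
  then obtain Q where Q: "\<And>ij. Q ij \<subseteq> C" "\<And>ij. card (Q ij) \<le> K"
    "\<And>ij c. c \<in> eligible \<delta> F ij \<Longrightarrow>
      card (rect F ij c - \<Union> (rect F ij ` Q ij)) \<le> 1/100 * card (rect F ij c)"
    by metis
  have fQ: "finite (Q ij)" for ij using Q(1) fin finite_subset by blast
  define I where "I = Pow F \<times> Pow F"
  have fI: "finite I" and cI: "card I = 4 ^ card F"
    using fF by (simp_all add: I_def card_cartesian_product card_Pow flip: power_mult_distrib)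
  define F' where "F' = F \<union> (\<Union>ij\<in>I. Q ij)"
  have FF': "F \<subseteq> F'" by (simp add: F'_def)
  have "F' \<subseteq> C" using F Q(1) by (auto simp: F'_def)
  have "card F' \<le> card F + card (\<Union>ij\<in>I. Q ij)" unfolding F'_def by (rule card_Un_le)
  also have "card (\<Union>ij\<in>I. Q ij) \<le> (\<Sum>ij\<in>I. card (Q ij))" by (rule card_UN_le[OF fI])
  also have "\<dots> \<le> (\<Sum>ij\<in>I. K)" by (intro sum_mono Q)
  also have "\<dots> = 4 ^ card F * K" using cI by simp
  finally have cF': "card F' \<le> card F + 4 ^ card F * K" by simp

  define S where "S ij = \<Union> (rect F ij ` Q ij)" for ij
  define U where "U ij = partA F (fst ij) \<times> partB F (snd ij)" for ij
  define heavy where "heavy ij \<longleftrightarrow> 2 * card (U ij \<inter> S ij) \<ge> card (U ij)" for ij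
  have fU: "finite (U ij)" for ij using fin_part by (simp add: U_def)
  have S_U: "S ij \<subseteq> U ij" for ij by (auto simp: S_def U_def rect_def split: prod.splits)
  \<comment> \<open>All covering indices belong to \<open>F'\<close>, so the new labels decide
    membership in \<open>S ij\<close>, as \<open>rel_entropy_ge_half\<close> requires.\<close>
  have S_union: "v \<in> S ij \<longleftrightarrow> w \<in> S ij"
    if "ij \<in> I" "v \<in> U ij" "w \<in> U ij" "labAB F' v = labAB F' w" for ij v w
  proof -
    have *: "fst v \<in> nbA c \<longleftrightarrow> fst w \<in> nbA c" "snd v \<in> nbB c \<longleftrightarrow> snd w \<in> nbB c"
      if "c \<in> Q ij" for c
    proof -
      have "c \<in> F'" using \<open>c \<in> Q ij\<close> \<open>ij \<in> I\<close> by (auto simp: F'_def)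
      moreover have "labA F' (fst v) = labA F' (fst w)" "labB F' (snd v) = labB F' (snd w)"
        using \<open>labAB F' v = labAB F' w\<close> by (auto simp: labAB_def split: prod.splits)
      ultimately show "fst v \<in> nbA c \<longleftrightarrow> fst w \<in> nbA c" "snd v \<in> nbB c \<longleftrightarrow> snd w \<in> nbB c"
        unfolding labA_def labB_def by blast+
    qed
    have "x \<in> S ij \<longleftrightarrow> (\<exists>c\<in>Q ij. fst x \<in> nbA c \<and> snd x \<in> nbB c)" if "x \<in> U ij" for x
      using that by (auto simp: S_def U_def rect_def split: prod.splits)
    then show ?thesis using * that by auto
  qed
  \<comment> \<open>At most \<open>K\<close> rectangles, each with at most \<open>n\<close> edges by
    \<open>card_rect\<close>.\<close>
  have G_S: "card (G \<inter> S ij) \<le> K * n" for ij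
  proof -
    have "G \<inter> S ij = (\<Union>c\<in>Q ij. G \<inter> rect F ij c)" by (auto simp: S_def)
    also have "card \<dots> \<le> (\<Sum>c\<in>Q ij. card (G \<inter> rect F ij c))" by (rule card_UN_le[OF fQ])
    also have "\<dots> \<le> (\<Sum>c\<in>Q ij. n)"
    proof (rule sum_mono)
      fix c
      have "card (G \<inter> rect F ij c) \<le> card (G \<inter> nbA c \<times> nbB c)"
        using fin_G by (intro card_mono) (auto simp: rect_def split: prod.splits)
      then show "card (G \<inter> rect F ij c) \<le> n" using card_rect[of c] by simp
    qed
    also have "\<dots> \<le> K * n" using Q(2) by simp
    finally show ?thesis .
  qed

  let ?E = "\<lambda>ij. {e\<in>G. labAB F e = ij}"
  let ?hv = "\<lambda>ij. if heavy ij then 1/3 else 0 :: real"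
  have E_U: "?E ij \<subseteq> U ij" for ij
    using G_sub by (auto simp: U_def partA_def partB_def labAB_def)
  have img: "labAB F ` G \<subseteq> I" unfolding I_def by (intro image_subsetI labAB_mem)
  have "(\<Sum>ij\<in>labAB F ` G. rel_entropy (labAB F') (?E ij) (U ij))
     \<ge> (\<Sum>ij\<in>labAB F ` G. card (?E ij) * ?hv ij - 2 * (K * n))"
  proof (rule sum_mono)
    fix ij assume "ij \<in> labAB F ` G"
    then have ij: "ij \<in> I" using img by blast
    show "rel_entropy (labAB F') (?E ij) (U ij) \<ge> card (?E ij) * ?hv ij - 2 * (K * n)"
    proof (cases "heavy ij")
      case True
      have "rel_entropy (labAB F') (?E ij) (U ij) \<ge> card (?E ij) / 3 - 2 * card (?E ij \<inter> S ij)"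
        using True S_union[OF ij] unfolding heavy_def
        by - (rule rel_entropy_ge_half[OF fU E_U], blast+)
      moreover have "card (?E ij \<inter> S ij) \<le> card (G \<inter> S ij)"
        using fin_G by (intro card_mono) auto
      then have "card (?E ij \<inter> S ij) \<le> K * n" using G_S[of ij] by simp
      then have "real (card (?E ij \<inter> S ij)) \<le> K * n" by (metis of_nat_le_iff)
      ultimately show ?thesis using True by simp
    next
      case False
      have "rel_entropy (labAB F') (?E ij) (U ij) \<ge> 0" by (rule rel_entropy_nonneg[OF fU E_U])
      moreover have "real (2 * (K * n)) \<ge> 0" by (rule of_nat_0_le_iff)
      ultimately show ?thesis using False by (simp only: if_False mult_zero_right)
    qed
  qed
  also have "(\<Sum>ij\<in>labAB F ` G. card (?E ij) * ?hv ij - 2 * (K * n))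
    = (\<Sum>ij\<in>labAB F ` G. card (?E ij) * ?hv ij) - card (labAB F ` G) * (2 * (K * n))"
    by (simp add: sum_subtractf)
  \<comment> \<open>The gain 1/3 per edge in a heavy pair is credited to the triple of that
    edge.\<close>
  also have "(\<Sum>ij\<in>labAB F ` G. card (?E ij) * ?hv ij) = (\<Sum>e\<in>G. ?hv (labAB F e))"
    by (subst sum.image_gen[OF fin_G, of _ "labAB F"]) (auto intro!: sum.cong)
  also have "\<dots> = (\<Sum>(a, b, c)\<in>T. ?hv (labA F a, labB F b))"
    by (subst sum.reindex_bij_betw[OF bij_T_G, symmetric]) (auto simp: labAB_def case_prod_beta)
  finally have part1: "(\<Sum>ij\<in>labAB F ` G. rel_entropy (labAB F') (?E ij) (U ij))
    \<ge> (\<Sum>(a, b, c)\<in>T. ?hv (labA F a, labB F b)) - card (labAB F ` G) * (2 * (K * n))" .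
  have "card (labAB F ` G) * (K * n) \<le> 4 ^ card F * (K * n)"
    using card_mono[OF fI img] cI by (intro mult_right_mono) auto
  then have "100 * (card (labAB F ` G) * (K * n)) \<le> card T"
    using large unfolding mult.assoc by linarith
  then have loss: "100 * (real (card (labAB F ` G)) * (K * n)) \<le> card T"
    by (metis of_nat_le_iff of_nat_mult of_nat_numeral)

  let ?lowA = "\<lambda>a c. of_bool (card (nbA c \<inter> partA F (labA F a)) < \<delta> * card (partA F (labA F a))) :: real"
  let ?lowB = "\<lambda>b c. of_bool (card (nbB c \<inter> partB F (labB F b)) < \<delta> * card (partB F (labB F b))) :: real"
  \<comment> \<open>A triple in a heavy pair earns 1/3; an eligible one in a light pair earns
    \<open>1/3 - 2/100 = 47/150\<close>; for a triple with a thin side the right-hand side is at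
    most 0.\<close>
  have pw: "?hv (labA F a, labB F b) + (gainA F F' c (labA F a) + gainB F F' c (labB F b))
      \<ge> 47/150 * (1 - ?lowA a c - ?lowB b c)" if T: "(a, b, c) \<in> T" for a b c
  proof -
    define ij where "ij = (labA F a, labB F b)"
    have ij: "ij \<in> I" by (auto simp: ij_def I_def labA_def labB_def)
    have nn: "gainA F F' c (labA F a) \<ge> 0" "gainB F F' c (labB F b) \<ge> 0" by (rule gain_nonneg)+
    have "heavy ij \<or> ?lowA a c = 1 \<or> ?lowB b c = 1 \<or> (\<not> heavy ij \<and> c \<in> eligible \<delta> F ij)"
      using T_CD[OF T] by (auto simp: eligible_def ij_def)
    then consider "heavy ij" | "?lowA a c = 1" | "?lowB b c = 1"
      | "\<not> heavy ij" "c \<in> eligible \<delta> F ij" by blast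
    then show ?thesis
    proof cases
      case 4
      define X where "X = nbA c \<inter> partA F (labA F a)"
      define Y where "Y = nbB c \<inter> partB F (labB F b)"
      have "a \<in> X" "b \<in> Y"
        using T T_sub by (auto simp: X_def Y_def nbA_def nbB_def partA_def partB_def)
      then have XY: "card X > 0" "card Y > 0"
        using fin_nb by (auto simp: X_def Y_def card_gt_0_iff)
      have rXY: "rect F ij c = X \<times> Y" by (simp add: rect_def ij_def X_def Y_def)
      have UU: "U ij = partA F (labA F a) \<times> partB F (labB F b)" by (simp add: U_def ij_def)
      have XYU: "X \<times> Y \<subseteq> U ij" by (auto simp: UU X_def Y_def)
      \<comment> \<open>For a light pair the roles are exchanged: the complement of \<open>S\<close>
        fills half of the pair, and the rectangle mostly avoids that complement.\<close>
      have "2 * card (U ij \<inter> - S ij) \<ge> card (U ij)"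
        using 4(1) card_Int_Diff[OF fU, of ij "S ij"] by (simp add: heavy_def Diff_eq)
      then have "rel_entropy (labAB F') (X \<times> Y) (U ij) \<ge> card (X \<times> Y) / 3 - 2 * card (X \<times> Y \<inter> - S ij)"
        using S_union[OF ij] by - (rule rel_entropy_ge_half[OF fU XYU], blast+)
      also have "card (X \<times> Y \<inter> - S ij) = card (rect F ij c - \<Union> (rect F ij ` Q ij))"
        by (simp add: rXY S_def Diff_eq)
      finally have "rel_entropy (labAB F') (X \<times> Y) (U ij) \<ge> 47/150 * card (X \<times> Y)"
        using Q(3)[OF 4(2)] rXY by simp
      moreover have "rel_entropy (labAB F') (X \<times> Y) (U ij)
          = card Y * rel_entropy (labA F') X (partA F (labA F a))
            + card X * rel_entropy (labB F') Y (partB F (labB F b))"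
        unfolding UU labAB_def by (rule rel_entropy_Times) (auto simp: fin_part X_def Y_def)
      ultimately have "47/150 * (card X * card Y) \<le> card Y * rel_entropy (labA F') X (partA F (labA F a))
            + card X * rel_entropy (labB F') Y (partB F (labB F b))"
        by (simp add: card_cartesian_product)
      \<comment> \<open>Division by \<open>card X * card Y\<close> turns the two entropies into the
        averages \<open>gainA\<close> and \<open>gainB\<close>.\<close>
      then have "47/150 \<le> rel_entropy (labA F') X (partA F (labA F a)) / card X
            + rel_entropy (labB F') Y (partB F (labB F b)) / card Y"
        using XY by (simp add: field_simps)
      then show ?thesis
        using 4(1) unfolding gainA_def gainB_def X_def[symmetric] Y_def[symmetric] ij_def by auto
    qed (use nn in \<open>auto simp: ij_def\<close>)
  qed
  have "(\<Sum>(a, b, c)\<in>T. ?hv (labA F a, labB F b))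
        + (\<Sum>(a, b, c)\<in>T. gainA F F' c (labA F a) + gainB F F' c (labB F b))
      = (\<Sum>(a, b, c)\<in>T. ?hv (labA F a, labB F b) + (gainA F F' c (labA F a) + gainB F F' c (labB F b)))"
    by (simp add: case_prod_beta flip: sum.distrib)
  also have "\<dots> \<ge> (\<Sum>(a, b, c)\<in>T. 47/150 * (1 - ?lowA a c - ?lowB b c))"
    by (rule sum_mono) (use pw in auto)
  also have "(\<Sum>(a, b, c)\<in>T. 47/150 * (1 - ?lowA a c - ?lowB b c))
    = 47/150 * (card T - (\<Sum>(a, b, c)\<in>T. ?lowA a c) - (\<Sum>(a, b, c)\<in>T. ?lowB b c))"
    by (simp only: case_prod_unfold sum_subtractf sum_constant mult_1_right flip: sum_distrib_left)
  finally have part2: "(\<Sum>(a, b, c)\<in>T. ?hv (labA F a, labB F b))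
        + (\<Sum>(a, b, c)\<in>T. gainA F F' c (labA F a) + gainB F F' c (labB F b))
     \<ge> 47/150 * (card T - (\<Sum>(a, b, c)\<in>T. ?lowA a c) - (\<Sum>(a, b, c)\<in>T. ?lowB b c))" .
  have "100 * (n * (\<delta> * n)) \<le> card T" using \<epsilon> by (simp add: \<delta>_def power2_eq_square mult_ac)
  then have "100 * (\<Sum>(a, b, c)\<in>T. ?lowA a c) \<le> card T" "100 * (\<Sum>(a, b, c)\<in>T. ?lowB b c) \<le> card T"
    using card_lowA[of \<delta> F] card_lowB[of \<delta> F] \<delta> by linarith+
  \<comment> \<open>\<open>47/150 * (1 - 2/100) - 2/100\<close> exceeds 1/4.\<close>
  with part1 part2 loss have "potential F' - potential F \<ge> card T / 4"
    unfolding potential_diff[OF FF'] U_def by simp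
  then show ?thesis using that[of F'] \<open>F' \<subseteq> C\<close> cF' by simp
qed

lemma potential_iterate:
  fixes \<epsilon> :: real and K :: nat
  assumes \<epsilon>: "0 < \<epsilon>" "\<epsilon> * n ^ 2 \<le> card T" and K: "K \<ge> 10 ^ 6 / \<epsilon> ^ 2"
    and large: "100 * (4 ^ label_bound K t * K * n) \<le> card T"
  shows "\<exists>F\<subseteq>C. card F \<le> label_bound K t \<and> potential F \<ge> potential {} + t * (card T / 4)"
  using large
proof (induction t)
  case 0
  then show ?case by (intro exI[of _ "{}"]) simp
next
  case (Suc t)
  \<comment> \<open>The bounds grow with \<open>t\<close>, so largeness at the last step covers the
    earlier ones.\<close>
  have "(4::nat) ^ label_bound K t \<le> 4 ^ label_bound K (Suc t)" by (intro power_increasing) auto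
  then have "100 * (4 ^ label_bound K t * K * n) \<le> 100 * (4 ^ label_bound K (Suc t) * K * n)"
    by (intro mult_left_mono mult_right_mono) auto
  then have l: "100 * (4 ^ label_bound K t * K * n) \<le> card T" using Suc.prems by linarith
  from Suc.IH[OF this] obtain F where F: "F \<subseteq> C" "card F \<le> label_bound K t"
    "potential F \<ge> potential {} + t * (card T / 4)" by blast
  have p: "(4::nat) ^ card F \<le> 4 ^ label_bound K t" using F by (intro power_increasing) auto
  then have "100 * (4 ^ card F * K * n) \<le> 100 * (4 ^ label_bound K t * K * n)"
    by (intro mult_left_mono mult_right_mono) auto
  then have "100 * (4 ^ card F * K * n) \<le> card T" using l by linarith
  from potential_step[OF F(1) \<epsilon> K this] obtain F' where F': "F' \<subseteq> C"
    "card F' \<le> card F + 4 ^ card F * K" "potential F' \<ge> potential F + card T / 4" .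
  have "card F' \<le> label_bound K (Suc t)"
    using F'(2) F(2) mult_right_mono[OF p, of K] unfolding label_bound.simps by linarith
  moreover have "potential F' \<ge> potential {} + Suc t * (card T / 4)"
    using F'(3) F(3) by (simp add: field_simps)
  ultimately show ?case using F'(1) by blast
qed

text \<open>Otherwise the potential starts at no less than \<open>3 * card T * ln \<epsilon>\<close>
  and rises by \<open>card T / 4\<close> in each of \<open>t\<close> steps, which takes it above
  0.\<close>

lemma card_triples_less:
  fixes \<epsilon> :: real and K :: nat
  assumes \<epsilon>: "0 < \<epsilon>" "\<epsilon> \<le> 1" and K: "K \<ge> 10 ^ 6 / \<epsilon> ^ 2" and t: "t > 12 * ln (1 / \<epsilon>)"
    and n: "n \<ge> 4 ^ label_bound K t * K ^ 2"
  shows "card T < \<epsilon> * n ^ 2"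
proof (rule ccontr)
  assume "\<not> card T < \<epsilon> * n ^ 2"
  then have T: "\<epsilon> * n ^ 2 \<le> card T" by simp
  have K0: "K > 0" using K \<epsilon> by (cases "K = 0") auto
  then have "4 ^ label_bound K t * K ^ 2 > 0" by simp
  then have n0: "n > 0" using n by linarith
  have "\<epsilon> ^ 2 \<le> \<epsilon>" using \<epsilon> by (simp add: power2_eq_square mult_left_le)
  then have "10 ^ 6 / \<epsilon> \<le> 10 ^ 6 / \<epsilon> ^ 2" using \<epsilon> by (intro divide_left_mono) auto
  then have "K \<ge> 10 ^ 6 / \<epsilon>" using K by linarith
  then have K1: "\<epsilon> * K \<ge> 100" using \<epsilon> by (simp add: field_simps)
  \<comment> \<open>One factor \<open>K\<close> of the lower bound on \<open>n\<close> pays for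
    \<open>100 / \<epsilon>\<close>.\<close>
  have "100 * (4 ^ label_bound K t * K * real n) \<le> (\<epsilon> * K) * (4 ^ label_bound K t * K * real n)"
    using K1 by (intro mult_right_mono) auto
  also have "\<dots> = \<epsilon> * (real (4 ^ label_bound K t * K ^ 2) * n)" by (simp add: power2_eq_square)
  also have "\<dots> \<le> \<epsilon> * (real n * n)"
    using n \<epsilon> by (intro mult_left_mono mult_right_mono of_nat_mono) auto
  also have "\<dots> \<le> card T" using T by (simp add: power2_eq_square)
  finally have "real (100 * (4 ^ label_bound K t * K * n)) \<le> real (card T)" by simp
  then have "100 * (4 ^ label_bound K t * K * n) \<le> card T" by (simp only: of_nat_le_iff)
  from potential_iterate[OF \<epsilon>(1) T K this] obtain F where
    F: "potential F \<ge> potential {} + t * (card T / 4)" by blast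
  have m0: "card T > 0" using T \<epsilon> n0 by (metis mult_pos_pos of_nat_0_less_iff of_nat_power
      order_less_le_trans zero_less_power)
  then have "potential {} \<ge> 3 * (card T * ln (card T / n ^ 2))"
    by (intro potential_empty n0) auto
  moreover have "ln \<epsilon> \<le> ln (card T / n ^ 2)"
    using T \<epsilon> n0 m0 by (subst ln_le_cancel_iff) (auto simp: field_simps)
  then have "card T * ln (card T / n ^ 2) \<ge> card T * ln \<epsilon>" by (intro mult_left_mono) auto
  ultimately have "3 * (card T * ln \<epsilon>) + t * (card T / 4) \<le> 0"
    using F potential_nonpos[of F] by linarith
  then have "card T * (12 * ln \<epsilon> + t) \<le> 0" by (simp add: algebra_simps)
  then have "12 * ln \<epsilon> + t \<le> 0" using m0 by (simp add: mult_le_0_iff)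
  then show False using t \<epsilon> by (simp add: ln_div)
qed

end

section \<open>Towers and the iterated logarithm\<close>

primrec tower :: "nat \<Rightarrow> nat" where
  "tower 0 = 1"
| "tower (Suc k) = 2 ^ tower k"

lemma less_tower: "k < tower k"
proof (induction k)
  case (Suc k)
  have "tower k < 2 ^ tower k" by (rule less_exp)
  then show ?case using Suc.IH unfolding tower.simps by linarith
qed simp

lemma power_le_tower: "2 ^ k \<le> tower k"
proof (cases k)
  case (Suc j)
  then show ?thesis using less_tower[of j] by (simp add: power_increasing flip: power_Suc)
qed simp

lemma tower_mono: "j \<le> k \<Longrightarrow> tower j \<le> tower k"
proof (rule lift_Suc_mono_le[of tower])
  show "tower i \<le> tower (Suc i)" for i
    unfolding tower.simps by (rule less_imp_le[OF less_exp])
qed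

lemma four_mult_le_power: "x \<ge> 4 \<Longrightarrow> 4 * x \<le> (2::nat) ^ x"
  by (induction x rule: dec_induct) (auto simp: numeral_eq_Suc)

text \<open>Two more exponentials absorb one refinement: with \<open>x = tower k \<ge> 4\<close>
  both left sides are at most \<open>2 ^ (4 * x)\<close>, and
  \<open>4 * x \<le> 2 ^ x\<close>.\<close>

lemma power_tower_le:
  assumes "k \<ge> 2"
  shows "4 ^ tower k * tower k ^ 2 \<le> tower (k + 2)"
    and "tower k + 4 ^ tower k * tower k \<le> tower (k + 2)"
proof -
  define x where "x = tower k"
  have "tower 2 = 4" by (simp add: numeral_2_eq_2)
  then have x4: "x \<ge> 4" using tower_mono[OF assms] by (simp add: x_def)
  have xx: "x \<le> 2 ^ x" using less_exp[of x] by simp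
  have top: "2 ^ (4 * x) \<le> tower (k + 2)"
    using four_mult_le_power[OF x4] by (simp add: x_def power_increasing)
  have "(4::nat) ^ x = 2 ^ (2 * x)" by (simp add: power_mult)
  moreover have "((2::nat) ^ x) ^ 2 = 2 ^ (2 * x)" by (simp only: mult.commute flip: power_mult)
  ultimately have "(4::nat) ^ x * (2 ^ x) ^ 2 = 2 ^ (4 * x)" by (simp flip: power_add)
  moreover have "4 ^ x * x ^ 2 \<le> 4 ^ x * (2 ^ x) ^ 2"
    using xx by (intro mult_left_mono power_mono) auto
  ultimately show "4 ^ tower k * tower k ^ 2 \<le> tower (k + 2)"
    using top unfolding x_def by linarith
  have "x + 4 ^ x * x \<le> 4 ^ x * x + 4 ^ x * x" by simp
  also have "\<dots> = 4 ^ x * (2 * x)" by simp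
  also have "\<dots> \<le> 4 ^ x * x ^ 2" using x4 by (simp add: power2_eq_square)
  finally show "tower k + 4 ^ tower k * tower k \<le> tower (k + 2)"
    using \<open>4 ^ tower k * tower k ^ 2 \<le> tower (k + 2)\<close> by (simp add: x_def)
qed

text \<open>Each refinement costs two levels, starting from
  \<open>2 ^ j \<le> tower j\<close>.\<close>

lemma label_bound_le_tower:
  assumes "j \<ge> 2" shows "label_bound (2 ^ j) t \<le> tower (j + 2 * t)"
proof (induction t)
  case (Suc t)
  let ?x = "tower (j + 2 * t)"
  have "2 ^ j \<le> ?x" using power_le_tower[of j] tower_mono[of j "j + 2 * t"] by simp
  then have "4 ^ label_bound (2 ^ j) t * 2 ^ j \<le> 4 ^ ?x * ?x"
    using Suc by (intro mult_mono power_increasing) auto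
  then have "label_bound (2 ^ j) (Suc t) \<le> ?x + 4 ^ ?x * ?x" using Suc by simp
  also have "\<dots> \<le> tower (j + 2 * t + 2)" using assms by (intro power_tower_le) auto
  finally show ?case by (simp add: add.assoc)
qed simp

lemma log_star_le:
  fixes x :: real
  assumes "x \<le> tower k" shows "log_star x \<le> k"
proof -
  \<comment> \<open>Only some \<open>k' \<le> k\<close> is claimed, since iterates that have passed
    1 leave the positive reals.\<close>
  have "\<exists>k'\<le>k. (log 2 ^^ k') x \<le> 1" if "x \<le> tower k" for x :: real and k
    using that
  proof (induction k arbitrary: x)
    case 0
    then show ?case by auto
  next
    case (Suc k)
    show ?case
    proof (cases "x \<le> 1")
      case True
      then show ?thesis by (intro exI[of _ 0]) auto
    next
      case False
      have "x \<le> 2 powr tower k" using Suc.prems by (simp add: powr_realpow)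
      then have "log 2 x \<le> tower k" using False by (simp add: log_le_iff)
      from Suc.IH[OF this] obtain k' where "k' \<le> k" "(log 2 ^^ k') (log 2 x) \<le> 1" by blast
      then have "Suc k' \<le> Suc k \<and> (log 2 ^^ Suc k') x \<le> 1"
        by (simp only: funpow_Suc_right o_apply) simp
      then show ?thesis by blast
    qed
  qed
  from this[OF assms] show ?thesis
    unfolding log_star_def by (meson Least_le order_trans)
qed

lemma le_tower_log_star: "x \<le> tower (log_star x)"
proof -
  have "x \<le> tower k" if "(log 2 ^^ k) x \<le> 1" for x k
    using that
  proof (induction k arbitrary: x)
    case (Suc k)
    then have "(log 2 ^^ k) (log 2 x) \<le> 1" by (simp only: funpow_Suc_right o_apply)
    then have l: "log 2 x \<le> tower k" by (rule Suc.IH)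
    show ?case
    proof (cases "x > 0")
      case True
      then have "x \<le> 2 powr tower k" using l by (simp add: log_le_iff)
      then show ?thesis by (simp add: powr_realpow)
    next
      case False
      have "(0::real) \<le> tower (Suc k)" by simp
      then show ?thesis using False by linarith
    qed
  qed simp
  moreover have "(log 2 ^^ log_star x) x \<le> 1"
    unfolding log_star_def using log_star_exists by (rule LeastI_ex)
  ultimately show ?thesis by blast
qed

lemma (in rs_system) card_less_log_star:
  assumes L: "log_star n \<ge> 40"
  shows "card T < 2 powr (- real (log_star n) / 100) * n ^ 2"
proof -
  define l where "l = log_star n"
  \<comment> \<open>\<open>10 ^ 6 / \<epsilon> ^ 2\<close> is
    \<open>10 ^ 6 * 2 powr (l / 50)\<close>, hence at most \<open>2 ^ j\<close> because
    \<open>10 ^ 6 \<le> 2 ^ 20\<close>; and \<open>t > l / 8\<close> exceeds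
    \<open>12 * l / 100\<close>. The tower needed has height \<open>j + 2 * t + 2\<close>, about
    \<open>27/100 * l + 25\<close>, which is below \<open>l\<close> from 40 on.\<close>
  define \<epsilon> where "\<epsilon> = 2 powr (- real l / 100)"
  define j where "j = 21 + l div 50"
  define t where "t = l div 8 + 1"
  have \<epsilon>: "0 < \<epsilon>" "\<epsilon> \<le> 1"
    using powr_mono[of "- real l / 100" 0 2] by (simp_all add: \<epsilon>_def)
  have "real l / 50 \<le> real (l div 50 + 1)" by linarith
  then have "2 powr (real l / 50) \<le> 2 powr (real (l div 50 + 1))" by (intro powr_mono) auto
  also have "\<dots> = 2 ^ (l div 50 + 1)" by (rule powr_realpow) simp
  finally have "10 ^ 6 * 2 powr (real l / 50) \<le> 2 ^ 20 * 2 ^ (l div 50 + 1)"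
    by (intro mult_mono) auto
  moreover have "1 / \<epsilon> ^ 2 = 2 powr (real l / 50)"
    by (simp add: \<epsilon>_def power2_eq_square powr_minus_divide flip: powr_add)
  then have "10 ^ 6 / \<epsilon> ^ 2 = 10 ^ 6 * 2 powr (real l / 50)"
    by (metis divide_inverse inverse_eq_divide)
  moreover have "real (2 ^ j) = 2 ^ 20 * 2 ^ (l div 50 + 1)"
  proof -
    have "j = 20 + (l div 50 + 1)" by (simp add: j_def)
    then show ?thesis by (simp only: power_add of_nat_mult of_nat_power of_nat_numeral)
  qed
  ultimately have K: "real (2 ^ j) \<ge> 10 ^ 6 / \<epsilon> ^ 2" by linarith
  have "ln (1 / \<epsilon>) = real l / 100 * ln 2" by (simp add: \<epsilon>_def ln_div ln_powr)
  also have "\<dots> \<le> real l / 100 * 1"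
    using ln_le_minus_one[of "2::real"] by (intro mult_left_mono) auto
  finally have t: "real t > 12 * ln (1 / \<epsilon>)" unfolding t_def by linarith
  have "4 ^ label_bound (2 ^ j) t * (2 ^ j) ^ 2 \<le> 4 ^ tower (j + 2 * t) * tower (j + 2 * t) ^ 2"
  proof (intro mult_mono power_increasing power_mono)
    show "2 ^ j \<le> tower (j + 2 * t)"
      using power_le_tower[of j] tower_mono[of j "j + 2 * t"] by linarith
  qed (auto simp: j_def intro!: label_bound_le_tower)
  also have "\<dots> \<le> tower (j + 2 * t + 2)" by (intro power_tower_le) (simp add: j_def)
  also have "\<dots> \<le> n"
  proof (rule ccontr)
    assume "\<not> tower (j + 2 * t + 2) \<le> n"
    then have "l \<le> j + 2 * t + 2" unfolding l_def by (intro log_star_le) simp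
    then have "l \<le> 25 + l div 50 + 2 * (l div 8)" by (simp add: j_def t_def)
    moreover have False if "l \<le> 25 + x + 2 * y" "50 * x \<le> l" "8 * y \<le> l" for x y
      using that L unfolding l_def[symmetric] by linarith
    ultimately show False by (metis times_div_less_eq_dividend)
  qed
  finally show ?thesis
    using card_triples_less[OF \<epsilon> K t] unfolding \<epsilon>_def l_def by simp
qed

section \<open>Bounds on \<open>f\<^sup>(\<^sup>3\<^sup>)(n, 6, 3)\<close>\<close>

lemma uniform_hypergraphD:
  assumes "uniform_hypergraph r V E"
  shows "finite V" "finite E" "e \<in> E \<Longrightarrow> e \<subseteq> V" "e \<in> E \<Longrightarrow> card e = r" "e \<in> E \<Longrightarrow> finite e"
proof -
  show "finite V" "e \<in> E \<Longrightarrow> e \<subseteq> V" "e \<in> E \<Longrightarrow> card e = r" "e \<in> E \<Longrightarrow> finite e"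
    using assms unfolding uniform_hypergraph_def by (auto intro: finite_subset)
  have "E \<subseteq> Pow V" using assms unfolding uniform_hypergraph_def by blast
  then show "finite E" using assms unfolding uniform_hypergraph_def by (simp add: finite_subset)
qed

text \<open>Sparsity speaks only of sets of exactly six vertices; since \<open>V\<close> has at
  least six, a smaller union extends to such a set.\<close>

lemma sparse_63D:
  assumes u: "uniform_hypergraph 3 V E" and s: "sparse_hypergraph 6 3 V E" and V: "card V \<ge> 6"
    and e: "e1 \<in> E" "e2 \<in> E" "e3 \<in> E" "e1 \<noteq> e2" "e1 \<noteq> e3" "e2 \<noteq> e3"
  shows "card (e1 \<union> e2 \<union> e3) > 6"
proof (rule ccontr)
  note uD = uniform_hypergraphD[OF u]
  assume "\<not> ?thesis"
  then have c: "card (e1 \<union> e2 \<union> e3) \<le> 6" by simp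
  have sub: "e1 \<union> e2 \<union> e3 \<subseteq> V" using uD(3) e(1-3) by blast
  obtain W where W: "e1 \<union> e2 \<union> e3 \<subseteq> W" "W \<subseteq> V" "card W = 6"
    using exists_subset_between[OF c V sub uD(1)] by blast
  have "card {e1, e2, e3} \<le> card {h\<in>E. h \<subseteq> W}"
    using W e uD(2) by (intro card_mono) auto
  then have "card {h\<in>E. h \<subseteq> W} \<ge> 3" using e by simp
  then show False using s W unfolding sparse_hypergraph_def by blast
qed

lemma card_Un_meet:
  assumes "card e = 3" "card f = 3" "v \<in> e" "v \<in> f" "finite e'"
  shows "card (e \<union> e' \<union> f) \<le> card (e \<union> e') + 2"
proof -
  have fin: "finite e" "finite f" using assms by (auto intro: card_ge_0_finite)
  have "card (e \<union> e' \<union> f) \<le> card ((e \<union> e') \<union> (f - {v}))"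
    using assms fin by (intro card_mono) auto
  also have "\<dots> \<le> card (e \<union> e') + card (f - {v})" by (rule card_Un_le)
  also have "card (f - {v}) = 2" using assms fin by simp
  finally show ?thesis .
qed

lemma sum_card_incidence:
  assumes "finite V" "finite E" "\<And>e. e \<in> E \<Longrightarrow> e \<inter> V \<noteq> {}" "\<And>v. v \<in> V \<Longrightarrow> card {e\<in>E. v \<in> e} \<le> k"
  shows "card E \<le> k * card V"
proof -
  have "E = (\<Union>v\<in>V. {e\<in>E. v \<in> e})" using assms(3) by blast
  then have "card E = card (\<Union>v\<in>V. {e\<in>E. v \<in> e})" by simp
  also have "\<dots> \<le> (\<Sum>v\<in>V. card {e\<in>E. v \<in> e})" by (rule card_UN_le[OF assms(1)])
  also have "\<dots> \<le> (\<Sum>v\<in>V. k)" by (intro sum_mono assms(4))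
  finally show ?thesis by (simp add: mult.commute)
qed

text \<open>Two edges sharing two vertices span at most four vertices, so no third edge can meet
  their union.\<close>

lemma card_overlapping_edges:
  assumes u: "uniform_hypergraph 3 V E" and s: "sparse_hypergraph 6 3 V E" and V: "card V \<ge> 6"
  shows "card {e\<in>E. \<exists>e'\<in>E. e' \<noteq> e \<and> card (e \<inter> e') \<ge> 2} \<le> 2 * card V"
proof -
  let ?E = "{e\<in>E. \<exists>e'\<in>E. e' \<noteq> e \<and> card (e \<inter> e') \<ge> 2}"
  note E = uniform_hypergraphD(3-5)[OF u] and fV = uniform_hypergraphD(1)[OF u]
    and fE = uniform_hypergraphD(2)[OF u]
  \<comment> \<open>Of three such edges at \<open>v\<close>, the second and the third would both
    have to equal the partner \<open>e'\<close> of the first.\<close>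
  have "card {e\<in>?E. v \<in> e} \<le> 2" for v
  proof (rule ccontr)
    assume "\<not> card {e\<in>?E. v \<in> e} \<le> 2"
    then have "3 \<le> card {e\<in>?E. v \<in> e}" by simp
    then obtain T where T: "T \<subseteq> {e\<in>?E. v \<in> e}" "card T = 3" by (rule obtain_subset_with_card_n)
    then obtain e f g where efg: "T = {e, f, g}" "e \<noteq> f" "e \<noteq> g" "f \<noteq> g"
      by (auto simp: card_3_iff)
    have mem: "e \<in> ?E" "f \<in> E" "g \<in> E" "v \<in> e" "v \<in> f" "v \<in> g" using T efg by auto
    then obtain e' where e': "e' \<in> E" "e' \<noteq> e" "card (e \<inter> e') \<ge> 2" by auto
    have eE: "e \<in> E" using mem by simp
    have "card (e \<union> e') + card (e \<inter> e') = 6"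
      using E[OF eE] E[OF e'(1)] by (simp flip: card_Un_Int)
    then have c4: "card (e \<union> e') \<le> 4" using e'(3) by linarith
    have no: "h = e'" if "h \<in> E" "h \<noteq> e" "v \<in> h" for h
    proof (rule ccontr)
      assume "h \<noteq> e'"
      then have "card (e \<union> e' \<union> h) > 6"
        using that e' eE by (intro sparse_63D[OF u s V]) auto
      moreover have "card (e \<union> e' \<union> h) \<le> card (e \<union> e') + 2"
        using E[OF eE] E[OF e'(1)] E[OF that(1)] mem that by (intro card_Un_meet[of _ _ v]) auto
      ultimately show False using c4 by linarith
    qed
    show False using no[of f] no[of g] mem efg by auto
  qed
  then have "card ?E \<le> 2 * card V"
  proof (intro sum_card_incidence)
    show "e \<inter> V \<noteq> {}" if "e \<in> ?E" for e
      using E[of e] that by (metis (no_types, lifting) card.empty inf.absorb1 mem_Collect_eq zero_neq_numeral)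
  qed (use fE fV in auto)
  then show ?thesis .
qed

lemma sorted_triple_eq:
  fixes a b c :: "'a :: linorder"
  assumes "{a, b, c} = {a', b', c'}" "a < b" "b < c" "a' < b'" "b' < c'"
  shows "a = a'" "b = b'" "c = c'"
proof -
  have "[a, b, c] = [a', b', c']"
    using assms by (intro sorted_distinct_set_unique) auto
  then show "a = a'" "b = b'" "c = c'" by auto
qed

lemma sorted_triple_exists:
  fixes e :: "'a :: linorder set"
  assumes "card e = 3" obtains a b c where "e = {a, b, c}" "a < b" "b < c"
proof -
  have fe: "finite e" using assms by (auto intro: card_ge_0_finite)
  define xs where "xs = sorted_list_of_set e"
  have "length xs = 3" "set xs = e" "sorted_wrt (<) xs"
    using assms fe by (auto simp: xs_def)
  then obtain a b c where "xs = [a, b, c]"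
    by (auto simp: numeral_3_eq_3 length_Suc_conv)
  then show ?thesis using \<open>set xs = e\<close> \<open>sorted_wrt (<) xs\<close> that[of a b c] by auto
qed

text \<open>Listing edges in increasing order makes the hypergraph tripartite over three copies of
  \<open>V\<close> without loss. Outside \<open>E0\<close> an edge shares at most one vertex with
  any other edge, and a violation of \<open>induced\<close> would be three edges on the six vertices
  \<open>a, a', b, b', c, c'\<close>.\<close>

lemma sparse_63_rs_system:
  fixes V :: "'a :: linorder set"
  assumes u: "uniform_hypergraph 3 V E" and s: "sparse_hypergraph 6 3 V E" and V: "card V \<ge> 6"
  obtains T where "rs_system V V V T (card V)" "card E \<le> card T + 2 * card V"
proof -
  define E0 where "E0 = {e\<in>E. \<exists>e'\<in>E. e' \<noteq> e \<and> card (e \<inter> e') \<ge> 2}"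
  define T where "T = {(a, b, c). a < b \<and> b < c \<and> {a, b, c} \<in> E - E0}"
  note E = uniform_hypergraphD(3-5)[OF u] and fV = uniform_hypergraphD(1)[OF u]
    and fE = uniform_hypergraphD(2)[OF u]
  have T_sub: "T \<subseteq> V \<times> V \<times> V" using E(1) by (fastforce simp: T_def)
  then have fT: "finite T" using fV by (simp add: finite_subset)
  have lin: "e = f" if "e \<in> E - E0" "f \<in> E" "x \<noteq> y" "{x, y} \<subseteq> e" "{x, y} \<subseteq> f" for e f x y
  proof (rule ccontr)
    assume "e \<noteq> f"
    then have "card (e \<inter> f) < 2" using that by (auto simp: E0_def not_le[symmetric])
    moreover have "card {x, y} \<le> card (e \<inter> f)"
      using that E[of e] by (intro card_mono) (auto intro: finite_subset)
    ultimately show False using that by simp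
  qed
  have "rs_system V V V T (card V)"
  proof
    show "a' = a" if "(a, b, c) \<in> T" "(a', b, c) \<in> T" for a a' b c
    proof -
      have "{a', b, c} = {a, b, c}" using that by (intro lin[of _ _ b c]) (auto simp: T_def)
      then show ?thesis using that by (intro sorted_triple_eq(1)[of a' b c a b c]) (auto simp: T_def)
    qed
    show "b' = b" if "(a, b, c) \<in> T" "(a, b', c) \<in> T" for a b b' c
    proof -
      have "{a, b', c} = {a, b, c}" using that by (intro lin[of _ _ a c]) (auto simp: T_def)
      then show ?thesis using that by (intro sorted_triple_eq(2)[of a b' c a b c]) (auto simp: T_def)
    qed
    show "c' = c" if T: "(a, b', c) \<in> T" "(a', b, c) \<in> T" "(a, b, c') \<in> T" for a a' b b' c c'
    proof (rule ccontr)
      assume c: "c' \<noteq> c"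
      have 1: "{a, b', c} \<noteq> {a, b, c'}" "{a', b, c} \<noteq> {a, b, c'}"
        using c T sorted_triple_eq(3)[of a b' c a b c'] sorted_triple_eq(3)[of a' b c a b c']
        by (auto simp: T_def)
      \<comment> \<open>The degenerate case: equality gives \<open>b' = b\<close>, so the third edge
        shares \<open>a\<close> and \<open>b\<close> with the first.\<close>
      have 2: "{a, b', c} \<noteq> {a', b, c}"
      proof
        assume "{a, b', c} = {a', b, c}"
        then have "b' = b" using T by (intro sorted_triple_eq(2)[of a b' c a' b c]) (auto simp: T_def)
        then have "{a, b, c'} = {a, b, c}" using T by (intro lin[of _ _ a b]) (auto simp: T_def)
        then show False using 1 \<open>b' = b\<close> by simp
      qed
      have "card ({a, b', c} \<union> {a', b, c} \<union> {a, b, c'}) > 6"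
        using T 1 2 by (intro sparse_63D[OF u s V]) (auto simp: T_def)
      moreover have "{a, b', c} \<union> {a', b, c} \<union> {a, b, c'} = set [a, a', b, b', c, c']" by auto
      moreover have "card (set [a, a', b, b', c, c']) \<le> 6"
        using card_length[of "[a, a', b, b', c, c']"] by simp
      ultimately show False by simp
    qed
  qed (use T_sub fV in auto)
  moreover have "card E \<le> card T + 2 * card V"
  proof -
    have "E - E0 \<subseteq> (\<lambda>(a, b, c). {a, b, c}) ` T"
    proof
      fix e assume e: "e \<in> E - E0"
      then obtain a b c where "e = {a, b, c}" "a < b" "b < c"
        using E(2) by (metis DiffD1 sorted_triple_exists)
      then show "e \<in> (\<lambda>(a, b, c). {a, b, c}) ` T" using e by (force simp: T_def)
    qed
    then have "card (E - E0) \<le> card T" using fT by (rule surj_card_le[rotated])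
    moreover have "card E0 \<le> 2 * card V" unfolding E0_def by (rule card_overlapping_edges[OF u s V])
    moreover have "card E \<le> card (E - E0) + card E0"
      using diff_card_le_card_Diff[of E0 E] fE by (simp add: E0_def)
    ultimately show ?thesis by linarith
  qed
  ultimately show ?thesis by (rule that)
qed

lemma hyp_extremal_ge:
  assumes "uniform_hypergraph r {1..n} E" "sparse_hypergraph v e {1..n} E" "e > 0"
  shows "card E \<le> hyp_extremal r n v e"
  unfolding hyp_extremal_def using assms by (intro Max_ge hyp_extremal_sizes) auto

text \<open>The \<open>2 * n\<close> edges lost to overlaps are absorbed into the constant 3,
  because \<open>2 powr (l / 100) \<le> 2 ^ (l - 1) \<le> tower (l - 1) < n\<close>.\<close>

lemma hyp_extremal_upper:
  assumes L: "log_star n \<ge> 40"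
  shows "real (hyp_extremal 3 n 6 3) \<le> 3 * 2 powr (- real (log_star n) / 100) * n ^ 2"
proof -
  define l where "l = log_star n"
  have tl: "n > tower (l - 1)"
  proof (rule ccontr)
    assume "\<not> n > tower (l - 1)"
    then have "l \<le> l - 1" unfolding l_def by (intro log_star_le) simp
    then show False using L by (simp add: l_def)
  qed
  then have nl: "2 ^ (l - 1) \<le> n" using power_le_tower[of "l - 1"] by simp
  have "l - 1 \<ge> 3" using L by (simp add: l_def)
  then have "(2::nat) ^ 3 \<le> 2 ^ (l - 1)" by (intro power_increasing) auto
  then have n6: "n \<ge> 6" using nl by simp
  obtain E where E: "uniform_hypergraph 3 {1..n} E" "sparse_hypergraph 6 3 {1..n} E"
    "card E = hyp_extremal 3 n 6 3"
    using Max_in[OF hyp_extremal_sizes[of 3 3 n 6]] unfolding hyp_extremal_def by auto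
  obtain T where T: "rs_system {1..n} {1..n} {1..n} T n" "card E \<le> card T + 2 * n"
    using sparse_63_rs_system[OF E(1,2)] n6 by auto
  have cT: "card T < 2 powr (- real l / 100) * n ^ 2"
    using rs_system.card_less_log_star[OF T(1) L] by (simp add: l_def)
  have "2 powr (real l / 100) \<le> 2 powr (real (l - 1))"
    using L by (intro powr_mono) (auto simp: l_def)
  also have "\<dots> = 2 ^ (l - 1)" by (simp add: powr_realpow)
  also have "\<dots> \<le> n" using nl by (metis of_nat_le_iff of_nat_numeral of_nat_power)
  finally have "2 powr (- real l / 100) * 2 powr (real l / 100) * n \<le> 2 powr (- real l / 100) * n * n"
    unfolding mult.assoc by (intro mult_left_mono) (auto intro: mult_right_mono)
  then have "n \<le> 2 powr (- real l / 100) * n ^ 2"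
    by (simp add: power2_eq_square mult_ac flip: powr_add)
  moreover have "real (card E) \<le> card T + 2 * real n" using T(2) by linarith
  ultimately show ?thesis using cT E(3) by (simp add: l_def)
qed

text \<open>Disjoint triples: any three of them cover nine vertices. The linear growth later absorbs
  the quadratic terms of the bound on \<open>NRD\<close>.\<close>

lemma hyp_extremal_lower: "n div 3 \<le> hyp_extremal 3 n 6 3"
proof -
  define blk where "blk k = {3 * k + 1, 3 * k + 2, 3 * k + (3::nat)}" for k
  define E where "E = blk ` {..<n div 3}"
  have cb: "card (blk k) = 3" "finite (blk k)" for k by (auto simp: blk_def)
  have dis: "k = j" if "x \<in> blk k" "x \<in> blk j" for x k j using that unfolding blk_def by auto
  have "inj blk" by (rule injI) (metis dis blk_def insertI1)
  then have cE: "card E = n div 3" unfolding E_def by (simp add: card_image inj_on_subset)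
  have "blk k \<subseteq> {1..n}" if "k < n div 3" for k using that by (auto simp: blk_def)
  then have u: "uniform_hypergraph 3 {1..n} E" using cb by (auto simp: uniform_hypergraph_def E_def)
  have "sparse_hypergraph 6 3 {1..n} E"
    unfolding sparse_hypergraph_def
  proof (clarify)
    fix W assume W: "W \<subseteq> {1..n}" "card W = 6" "3 \<le> card {h\<in>E. h \<subseteq> W}"
    have fW: "finite W" using W finite_subset by blast
    have "disjnt (blk k) (blk j)" if "blk k \<noteq> blk j" for k j
      using dis[of _ k j] that unfolding disjnt_iff by blast
    then have "pairwise disjnt {h\<in>E. h \<subseteq> W}" by (auto simp: pairwise_def E_def)
    then have "card (\<Union> {h\<in>E. h \<subseteq> W}) = (\<Sum>h\<in>{h\<in>E. h \<subseteq> W}. card h)"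
      using cb by (intro card_Union_disjoint) (auto simp: E_def)
    also have "\<dots> = (\<Sum>h\<in>{h\<in>E. h \<subseteq> W}. 3)" using cb by (intro sum.cong) (auto simp: E_def)
    finally have "card (\<Union> {h\<in>E. h \<subseteq> W}) \<ge> 9" using W by simp
    moreover have "card (\<Union> {h\<in>E. h \<subseteq> W}) \<le> card W" using fW by (intro card_mono) auto
    ultimately show False using W by simp
  qed
  from hyp_extremal_ge[OF u this] cE show ?thesis by simp
qed

section \<open>Chains of cubic length\<close>

lemma R_rel_iff:
  "[a, b, c, d] \<in> R_rel \<longleftrightarrow> d = Zero \<and> [a, b, c] \<in> P_rel \<or> d = Pos \<and> [a, b, c] \<in> Q_rel"
  by (auto simp: R_rel_def Q_rel_def P_rel_def)

lemma P_rel_iff: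
  "[a, b, c] \<in> P_rel \<longleftrightarrow> a = Neg \<and> (c = Neg \<or> b = Pos) \<or> a = Zero \<and> b = Neg \<and> c = Neg"
  by (cases a; cases b; cases c) (simp_all add: P_rel_def)

lemma Q_rel_iff:
  "[a, b, c] \<in> Q_rel \<longleftrightarrow> [a, b, c] \<in> P_rel \<or> a = Zero \<and> b = Zero \<and> c = Zero"
  by (auto simp: Q_rel_def)

text \<open>Reading numbers by their base \<open>N\<close> digits turns the order of the chain into
  the lexicographic order of \<open>(i, j, l)\<close>.\<close>

lemma div_mod_lex:
  fixes u t N :: nat
  assumes "u < t"
  shows "u div N div N < t div N div N
    \<or> u div N div N = t div N div N \<and> u div N mod N < t div N mod N
    \<or> u div N = t div N \<and> u mod N < t mod N"
proof -
  have less: "v mod N < w mod N" if "v < w" "v div N = w div N" for v w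
    using that by (metis div_mult_mod_eq nat_add_left_cancel_less)
  have "u div N \<le> t div N" using assms by (intro div_le_mono) simp
  then have "u div N div N \<le> t div N div N" by (rule div_le_mono)
  with \<open>u div N \<le> t div N\<close> show ?thesis using less[of u t] less[of "u div N" "t div N"] assms
    by (cases "u div N = t div N"; cases "u div N div N = t div N div N") auto
qed

text \<open>The constraints \<open>(x\<^sub>i, y\<^sub>j, z\<^sub>i\<^sub>+\<^sub>j, w\<^sub>l)\<close> in lexicographic order of \<open>(i, j, l)\<close>, where the variables
  \<open>x\<close>, \<open>y\<close>, \<open>z\<close>, \<open>w\<close> occupy consecutive blocks of lengths \<open>N\<close>, \<open>N\<close>, \<open>2 N\<close>, \<open>N\<close>.\<close>

definition chain_constraint :: "nat \<Rightarrow> nat \<Rightarrow> nat list" where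
  "chain_constraint N t = (let i = t div N div N; j = t div N mod N; l = t mod N in
     [1 + i, N + 1 + j, 2 * N + 1 + (i + j), 4 * N + 1 + l])"

definition chain_assignment :: "nat \<Rightarrow> nat \<Rightarrow> nat \<Rightarrow> nat \<Rightarrow> nat \<Rightarrow> sgn3" where
  "chain_assignment N i j l v =
     (if v \<le> N then if v = 1 + i then Zero else Neg
      else if v \<le> 2 * N then if v = N + 1 + j then Zero else if v > N + 1 + j then Pos else Neg
      else if v \<le> 4 * N then if v = 2 * N + 1 + (i + j) then Zero else Neg
      else if v = 4 * N + 1 + l then Zero else Pos)"

lemma chain_assignment_simps:
  assumes "i' < N" "j' < N"
  shows "chain_assignment N i j l (1 + i') = (if i' = i then Zero else Neg)"
    "chain_assignment N i j l (N + 1 + j') = (if j' = j then Zero else if j' > j then Pos else Neg)"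
    "chain_assignment N i j l (2 * N + 1 + (i' + j')) = (if i' + j' = i + j then Zero else Neg)"
    "chain_assignment N i j l (4 * N + 1 + l') = (if l' = l then Zero else Pos)"
  using assms by (auto simp: chain_assignment_def)

lemma CL_R_rel_ge: "(n div 5) ^ 3 \<le> CL 4 R_rel n"
proof -
  define N where "N = n div 5"
  define Ss where "Ss = map (chain_constraint N) [0..<N * N * N]"
  have len: "length Ss = N ^ 3" by (simp add: Ss_def power3_eq_cube)
  have coord: "t div N div N < N" "t div N mod N < N" "t mod N < N" if "t < N * N * N" for t
  proof -
    have "N > 0" using that by (cases N) auto
    then show "t div N div N < N" "t div N mod N < N" "t mod N < N"
      using that by (auto simp: less_mult_imp_div_less)
  qed
  have "csp_instance 4 {1..n} (set Ss)"
  proof -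
    have "chain_constraint N t \<in> tuples 4 {1..n}" if "t < N * N * N" for t
    proof -
      have "5 * N \<le> n" by (simp add: N_def)
      then have "1 + i \<le> n \<and> N + 1 + j \<le> n \<and> 2 * N + 1 + (i + j) \<le> n \<and> 4 * N + 1 + l \<le> n"
        if "i < N" "j < N" "l < N" for i j l using that by linarith
      from this[OF coord[OF that]] show ?thesis
        by (simp add: chain_constraint_def tuples_def Let_def)
    qed
    then show ?thesis by (auto simp: csp_instance_def Ss_def)
  qed
  moreover have "chain_witness R_rel Ss"
    unfolding chain_witness_def
  proof (intro allI impI)
    fix t assume "t < length Ss"
    then have t: "t < N * N * N" by (simp add: Ss_def)
    define i j l where "i = t div N div N" and "j = t div N mod N" and "l = t mod N"
    let ?\<phi> = "chain_assignment N i j l"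
    have val: "map ?\<phi> (Ss ! u) = [if i' = i then Zero else Neg,
        if j' = j then Zero else if j' > j then Pos else Neg,
        if i' + j' = i + j then Zero else Neg, if l' = l then Zero else Pos]"
      if "u < N * N * N" "i' = u div N div N" "j' = u div N mod N" "l' = u mod N" for u i' j' l'
      using that coord[OF that(1)]
      by (simp add: Ss_def chain_constraint_def Let_def chain_assignment_simps del: One_nat_def)
    have "\<not> satisfies R_rel ?\<phi> (Ss ! t)"
      unfolding satisfies_def val[OF t i_def j_def l_def] by (simp add: R_rel_iff P_rel_iff)
    \<comment> \<open>For earlier \<open>(i', j', l')\<close> with \<open>i' < i\<close>, x gets
      \<open>Neg\<close>, and either z gets \<open>Neg\<close> or \<open>i' + j' = i + j\<close>, so
      that \<open>j' > j\<close> and y gets \<open>Pos\<close>. If \<open>i' = i\<close> and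
      \<open>j' < j\<close>, the values are \<open>Zero, Neg, Neg\<close>. If only \<open>l'\<close>
      differs, \<open>Zero, Zero, Zero\<close> lies in \<open>Q_rel\<close> and w gets
      \<open>Pos\<close>.\<close>
    moreover have "satisfies R_rel ?\<phi> (Ss ! u)" if u: "u < t" for u
    proof -
      have u': "u < N * N * N" using u t by simp
      show ?thesis
        using div_mod_lex[OF u, of N]
        unfolding satisfies_def val[OF u' refl refl refl] i_def[symmetric] j_def[symmetric] l_def[symmetric]
        by (elim disjE) (auto simp: R_rel_iff P_rel_iff Q_rel_iff i_def j_def l_def)
    qed
    ultimately show "\<exists>\<phi>. \<not> satisfies R_rel \<phi> (Ss ! t) \<and> (\<forall>u<t. satisfies R_rel \<phi> (Ss ! u))"
      by blast
  qed
  ultimately have "N ^ 3 \<in> {m. \<exists>Ss :: nat list list.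
     csp_instance 4 {1..n} (set Ss) \<and> chain_witness R_rel Ss \<and> length Ss = m}"
    using len by blast
  then show ?thesis unfolding CL_def N_def by (intro Max_ge CL_sizes) auto
qed

section \<open>Non-redundant instances\<close>

text \<open>The cuts respecting all of a set of edges form an elementary abelian 2-group; each edge
  of \<open>E\<close> cuts its order at least in half.\<close>

lemma card_separated_edges:
  assumes V: "finite V" and EV: "E \<subseteq> V \<times> V"
    and sep: "\<And>e. e \<in> E \<Longrightarrow> \<exists>X. (fst e \<in> X) \<noteq> (snd e \<in> X)
      \<and> (\<forall>e'\<in>E. e' \<noteq> e \<longrightarrow> (fst e' \<in> X) = (snd e' \<in> X))"
  shows "card E \<le> card V"
proof -
  define cuts where "cuts D = {X. X \<subseteq> V \<and> (\<forall>e\<in>D. (fst e \<in> X) = (snd e \<in> X))}" for D :: "('a \<times> 'a) set"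
  have fc: "finite (cuts D)" for D using V by (auto simp: cuts_def)
  have fE: "finite E" using V EV by (meson finite_SigmaI finite_subset)
  have "card (cuts D) * 2 ^ card D \<le> 2 ^ card V" if "finite D" "D \<subseteq> E" for D
    using that
  proof (induction D rule: finite_induct)
    case empty
    have "cuts {} = Pow V" by (auto simp: cuts_def)
    then show ?case using V by (simp add: card_Pow)
  next
    case (insert e D)
    then have e: "e \<in> E" by simp
    then obtain X0 where X0: "(fst e \<in> X0) \<noteq> (snd e \<in> X0)"
      "\<And>e'. e' \<in> E \<Longrightarrow> e' \<noteq> e \<Longrightarrow> (fst e' \<in> X0) = (snd e' \<in> X0)" using sep[OF e] by blast
    define X where "X = X0 \<inter> V"
    have X: "(fst e \<in> X) \<noteq> (snd e \<in> X)" "\<And>e'. e' \<in> E \<Longrightarrow> e' \<noteq> e \<Longrightarrow> (fst e' \<in> X) = (snd e' \<in> X)"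
      using X0 EV e by (fastforce simp: X_def)+
    \<comment> \<open>Symmetric difference with \<open>X\<close> is injective, preserves
      \<open>cuts D\<close> and changes whether \<open>e\<close> is cut, so the cuts for
      \<open>insert e D\<close> and their shifts are disjoint inside \<open>cuts D\<close>.\<close>
    define shift where "shift Y = (Y - X) \<union> (X - Y)" for Y
    have mem: "v \<in> shift Y \<longleftrightarrow> (v \<in> Y) \<noteq> (v \<in> X)" for v Y by (auto simp: shift_def)
    have "inj shift" by (rule injI) (use mem in blast)
    then have cs: "card (shift ` cuts (insert e D)) = card (cuts (insert e D))"
      by (intro card_image) (auto intro: inj_on_subset)
    have "shift ` cuts (insert e D) \<subseteq> cuts D"
    proof clarify
      fix Y assume Y: "Y \<in> cuts (insert e D)"
      have "shift Y \<subseteq> V" using Y by (auto simp: shift_def cuts_def X_def)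
      moreover have "(fst e' \<in> shift Y) = (snd e' \<in> shift Y)" if "e' \<in> D" for e'
        using Y X(2)[of e'] that insert.hyps insert.prems unfolding mem cuts_def by blast
      ultimately show "shift Y \<in> cuts D" by (simp add: cuts_def)
    qed
    moreover have "cuts (insert e D) \<subseteq> cuts D" by (auto simp: cuts_def)
    ultimately have "card (shift ` cuts (insert e D) \<union> cuts (insert e D)) \<le> card (cuts D)"
      using fc by (intro card_mono) auto
    moreover have "shift ` cuts (insert e D) \<inter> cuts (insert e D) = {}"
      using X(1) mem by (auto simp: cuts_def)
    ultimately have "card (cuts (insert e D)) + card (cuts (insert e D)) \<le> card (cuts D)"
      using fc by (simp add: card_Un_disjoint cs)
    then have "2 * card (cuts (insert e D)) * 2 ^ card D \<le> card (cuts D) * 2 ^ card D"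
      by (intro mult_right_mono) auto
    also have "\<dots> \<le> 2 ^ card V" using insert by simp
    finally show ?case using insert.hyps by (simp add: mult_ac)
  qed
  from this[OF fE order_refl] have c: "card (cuts E) * 2 ^ card E \<le> 2 ^ card V" .
  have "{} \<in> cuts E" by (simp add: cuts_def)
  then have "card (cuts E) \<ge> 1" using fc by (metis One_nat_def Suc_leI card_gt_0_iff empty_iff)
  then have "2 ^ card E \<le> card (cuts E) * 2 ^ card E" by simp
  then have "(2::nat) ^ card E \<le> 2 ^ card V" using c by linarith
  then show ?thesis by simp
qed

section \<open>Counting constraints whose violation lies outside \<open>Q_rel\<close>\<close>

lemma card_fibres_le:
  assumes T: "finite T" and V: "finite V" "g ` T \<subseteq> V" and k: "\<And>v. v \<in> V \<Longrightarrow> card {t\<in>T. g t = v} \<le> k"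
  shows "card T \<le> card V * k"
proof -
  have "T = (\<Union>v\<in>V. {t\<in>T. g t = v})" using V by auto
  then have "card T \<le> (\<Sum>v\<in>V. card {t\<in>T. g t = v})" using card_UN_le[OF V(1)] by metis
  also have "\<dots> \<le> card V * k" using sum_mono[OF k, of V] by simp
  finally show ?thesis .
qed

lemma card_image_square_le:
  assumes "finite V" "inj_on g T" "g ` T \<subseteq> V \<times> V"
  shows "card T \<le> card V ^ 2"
  using card_inj_on_le[OF assms(2,3)] assms(1) by (simp add: card_cartesian_product power2_eq_square)

text \<open>For a triple that shares each pair of its coordinates with some other triple, this
  leaves only two kinds of violation.\<close>

lemma Q_violation_cases:
  assumes "[a, b, c] \<notin> Q_rel" "[a, b, c'] \<in> Q_rel" "[a, b', c] \<in> Q_rel" "[a', b, c] \<in> Q_rel"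
  shows "a = Zero \<and> b = Zero \<and> c = Neg \<or> a = Neg \<and> b = Zero \<and> c = Zero"
  using assms by (cases a; cases b; cases c) (auto simp: Q_rel_iff P_rel_iff)

text \<open>Five classes of at most \<open>card V ^ 2\<close> triples. In \<open>Uz\<close>,
  \<open>Uy\<close>, \<open>Ux\<close> two coordinates determine the third. In \<open>N1\<close>
  with x fixed, and in \<open>N2\<close> with z fixed, the set of variables with value
  \<open>Zero\<close> separates only the remaining pair of its own triple, so
  \<open>card_separated_edges\<close> applies.\<close>

lemma card_non_redundant_Q:
  assumes V: "finite V" and TV: "T \<subseteq> V \<times> V \<times> V"
    and nr: "\<And>x y z. (x, y, z) \<in> T \<Longrightarrow> \<exists>\<phi>. [\<phi> x, \<phi> y, \<phi> z] \<notin> Q_rel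
      \<and> (\<forall>(x', y', z')\<in>T. (x', y', z') \<noteq> (x, y, z) \<longrightarrow> [\<phi> x', \<phi> y', \<phi> z'] \<in> Q_rel)"
  shows "card T \<le> 5 * card V ^ 2"
proof -
  have fT: "finite T" using TV V by (meson finite_SigmaI finite_subset)
  obtain \<phi> where \<phi>: "\<And>x y z. (x, y, z) \<in> T \<Longrightarrow> [\<phi> (x, y, z) x, \<phi> (x, y, z) y, \<phi> (x, y, z) z] \<notin> Q_rel"
    "\<And>x y z x' y' z'. (x, y, z) \<in> T \<Longrightarrow> (x', y', z') \<in> T \<Longrightarrow> (x', y', z') \<noteq> (x, y, z) \<Longrightarrow>
      [\<phi> (x, y, z) x', \<phi> (x, y, z) y', \<phi> (x, y, z) z'] \<in> Q_rel"
  proof -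
    have "\<forall>t\<in>T. \<exists>\<phi>. case t of (x, y, z) \<Rightarrow> [\<phi> x, \<phi> y, \<phi> z] \<notin> Q_rel
      \<and> (\<forall>(x', y', z')\<in>T. (x', y', z') \<noteq> (x, y, z) \<longrightarrow> [\<phi> x', \<phi> y', \<phi> z'] \<in> Q_rel)"
    proof
      fix t assume "t \<in> T"
      then show "\<exists>\<phi>. case t of (x, y, z) \<Rightarrow> [\<phi> x, \<phi> y, \<phi> z] \<notin> Q_rel
          \<and> (\<forall>(x', y', z')\<in>T. (x', y', z') \<noteq> (x, y, z) \<longrightarrow> [\<phi> x', \<phi> y', \<phi> z'] \<in> Q_rel)"
        using nr by (cases t) simp
    qed
    then obtain \<phi> where *: "\<forall>t\<in>T. case t of (x, y, z) \<Rightarrow> [\<phi> t x, \<phi> t y, \<phi> t z] \<notin> Q_rel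
      \<and> (\<forall>(x', y', z')\<in>T. (x', y', z') \<noteq> (x, y, z) \<longrightarrow> [\<phi> t x', \<phi> t y', \<phi> t z'] \<in> Q_rel)"
      unfolding bchoice_iff by blast
    show ?thesis
    proof (rule that[of \<phi>])
      fix x y z assume t: "(x, y, z) \<in> T"
      show "[\<phi> (x, y, z) x, \<phi> (x, y, z) y, \<phi> (x, y, z) z] \<notin> Q_rel"
        using bspec[OF * t] by simp
      fix x' y' z' assume "(x', y', z') \<in> T" "(x', y', z') \<noteq> (x, y, z)"
      then show "[\<phi> (x, y, z) x', \<phi> (x, y, z) y', \<phi> (x, y, z) z'] \<in> Q_rel"
        using bspec[OF * t] by auto
    qed
  qed
  define Uz where "Uz = {(x, y, z). (x, y, z) \<in> T \<and> (\<forall>z'. (x, y, z') \<in> T \<longrightarrow> z' = z)}"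
  define Uy where "Uy = {(x, y, z). (x, y, z) \<in> T \<and> (\<forall>y'. (x, y', z) \<in> T \<longrightarrow> y' = y)}"
  define Ux where "Ux = {(x, y, z). (x, y, z) \<in> T \<and> (\<forall>x'. (x', y, z) \<in> T \<longrightarrow> x' = x)}"
  define N1 where "N1 = {(x, y, z). (x, y, z) \<in> T \<and> \<phi> (x, y, z) x = Zero \<and> \<phi> (x, y, z) y = Zero \<and> \<phi> (x, y, z) z = Neg}"
  define N2 where "N2 = {(x, y, z). (x, y, z) \<in> T \<and> \<phi> (x, y, z) x = Neg \<and> \<phi> (x, y, z) y = Zero \<and> \<phi> (x, y, z) z = Zero}"
  have sub: "Uz \<subseteq> T" "Uy \<subseteq> T" "Ux \<subseteq> T" "N1 \<subseteq> T" "N2 \<subseteq> T"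
    by (auto simp: Uz_def Uy_def Ux_def N1_def N2_def)
  have "T \<subseteq> Uz \<union> Uy \<union> Ux \<union> N1 \<union> N2"
  proof (rule ccontr)
    assume "\<not> ?thesis"
    then obtain x y z where t: "(x, y, z) \<in> T" and nU: "(x, y, z) \<notin> N2" "(x, y, z) \<notin> N1"
      "(x, y, z) \<notin> Ux" "(x, y, z) \<notin> Uy" "(x, y, z) \<notin> Uz" by auto
    from t nU(3-5) obtain x' y' z' where "(x, y, z') \<in> T" "z' \<noteq> z" "(x, y', z) \<in> T" "y' \<noteq> y" "(x', y, z) \<in> T" "x' \<noteq> x"
      unfolding Ux_def Uy_def Uz_def by blast
    then have "[\<phi> (x, y, z) x, \<phi> (x, y, z) y, \<phi> (x, y, z) z'] \<in> Q_rel"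
      "[\<phi> (x, y, z) x, \<phi> (x, y, z) y', \<phi> (x, y, z) z] \<in> Q_rel"
      "[\<phi> (x, y, z) x', \<phi> (x, y, z) y, \<phi> (x, y, z) z] \<in> Q_rel"
      using t by (auto intro!: \<phi>(2))
    from Q_violation_cases[OF \<phi>(1)[OF t] this]
    show False using t nU(1,2) by (auto simp: N1_def N2_def)
  qed
  then have "card T \<le> card (Uz \<union> Uy \<union> Ux \<union> N1 \<union> N2)"
    using sub fT by (intro card_mono) (auto intro: finite_subset)
  also have "\<dots> \<le> card Uz + card Uy + card Ux + card N1 + card N2"
    by (meson add_mono card_Un_le le_refl order_trans)
  also have "\<dots> \<le> card V ^ 2 + card V ^ 2 + card V ^ 2 + card V ^ 2 + card V ^ 2"
  proof (intro add_mono)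
    show "card Uz \<le> card V ^ 2"
      using TV by (intro card_image_square_le[OF V, of "\<lambda>(x, y, z). (x, y)"])
        (auto simp: Uz_def inj_on_def)
    show "card Uy \<le> card V ^ 2"
      using TV by (intro card_image_square_le[OF V, of "\<lambda>(x, y, z). (x, z)"])
        (auto simp: Uy_def inj_on_def)
    show "card Ux \<le> card V ^ 2"
      using TV by (intro card_image_square_le[OF V, of "\<lambda>(x, y, z). (y, z)"])
        (auto simp: Ux_def inj_on_def)
    have "card {t\<in>N1. fst t = x} \<le> card V" for x
    proof -
      let ?L = "{(y, z). (x, y, z) \<in> N1}"
      have "card {t\<in>N1. fst t = x} = card ?L"
        by (intro bij_betw_same_card[of snd]) (force simp: bij_betw_def inj_on_def)
      also have "\<dots> \<le> card V"
      proof (rule card_separated_edges[OF V])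
        show "?L \<subseteq> V \<times> V" using TV sub(4) by auto
        fix e assume "e \<in> ?L"
        then obtain y z where e: "e = (y, z)" "(x, y, z) \<in> N1" by (cases e) auto
        let ?p = "\<phi> (x, y, z)"
        have t: "(x, y, z) \<in> T" "?p x = Zero" "?p y = Zero" "?p z = Neg" using e by (auto simp: N1_def)
        \<comment> \<open>The only tuples of \<open>Q_rel\<close> with first value
          \<open>Zero\<close> are \<open>[Zero, Neg, Neg]\<close> and
          \<open>[Zero, Zero, Zero]\<close>.\<close>
        have "(?p y' = Zero) = (?p z' = Zero)" if "(x, y', z') \<in> N1" "(y', z') \<noteq> (y, z)" for y' z'
        proof -
          have "[?p x, ?p y', ?p z'] \<in> Q_rel" using that t sub(4) by (intro \<phi>(2)) auto
          then show ?thesis using t by (auto simp: Q_rel_iff P_rel_iff)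
        qed
        then show "\<exists>X. (fst e \<in> X) \<noteq> (snd e \<in> X) \<and> (\<forall>e'\<in>?L. e' \<noteq> e \<longrightarrow> (fst e' \<in> X) = (snd e' \<in> X))"
          using t e by (intro exI[of _ "{v. ?p v = Zero}"]) auto
      qed
      finally show ?thesis .
    qed
    then show "card N1 \<le> card V ^ 2"
      using card_fibres_le[of N1 V fst] sub(4) fT V TV by (force simp: power2_eq_square intro: finite_subset)
    have "card {t\<in>N2. snd (snd t) = z} \<le> card V" for z
    proof -
      let ?L = "{(x, y). (x, y, z) \<in> N2}"
      have "card {t\<in>N2. snd (snd t) = z} = card ?L"
        by (intro bij_betw_same_card[of "\<lambda>(x, y, z). (x, y)"]) (force simp: bij_betw_def inj_on_def)
      also have "\<dots> \<le> card V"
      proof (rule card_separated_edges[OF V])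
        show "?L \<subseteq> V \<times> V" using TV sub(5) by auto
        fix e assume "e \<in> ?L"
        then obtain x y where e: "e = (x, y)" "(x, y, z) \<in> N2" by (cases e) auto
        let ?p = "\<phi> (x, y, z)"
        have t: "(x, y, z) \<in> T" "?p x = Neg" "?p y = Zero" "?p z = Zero" using e by (auto simp: N2_def)
        \<comment> \<open>The only tuples of \<open>Q_rel\<close> with last value
          \<open>Zero\<close> are \<open>[Neg, Pos, Zero]\<close> and
          \<open>[Zero, Zero, Zero]\<close>.\<close>
        have "(?p x' = Zero) = (?p y' = Zero)" if "(x', y', z) \<in> N2" "(x', y') \<noteq> (x, y)" for x' y'
        proof -
          have "[?p x', ?p y', ?p z] \<in> Q_rel" using that t sub(5) by (intro \<phi>(2)) auto
          then show ?thesis using t by (auto simp: Q_rel_iff P_rel_iff)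
        qed
        then show "\<exists>X. (fst e \<in> X) \<noteq> (snd e \<in> X) \<and> (\<forall>e'\<in>?L. e' \<noteq> e \<longrightarrow> (fst e' \<in> X) = (snd e' \<in> X))"
          using t e by (intro exI[of _ "{v. ?p v = Zero}"]) auto
      qed
      finally show ?thesis .
    qed
    then show "card N2 \<le> card V ^ 2"
      using card_fibres_le[of N2 V "\<lambda>t. snd (snd t)"] sub(5) fT V TV by (force simp: power2_eq_square intro: finite_subset)
  qed
  finally show ?thesis by simp
qed

section \<open>Tripartite reduction and triples violated by the all-zero assignment\<close>

lemma card_colourings:
  assumes V: "finite V" and xyz: "x \<in> V" "y \<in> V" "z \<in> V" "x \<noteq> y" "x \<noteq> z" "y \<noteq> z"
  shows "27 * card {\<kappa> \<in> V \<rightarrow>\<^sub>E {0, 1, 2::nat}. \<kappa> x = 0 \<and> \<kappa> y = 1 \<and> \<kappa> z = 2} = 3 ^ card V"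
proof -
  define F where "F v = (if v = x then {0} else if v = y then {1} else if v = z then {2} else {0, 1, 2::nat})" for v
  have Fx: "F x = {0}" "F y = {1}" "F z = {2}" using xyz by (simp_all add: F_def)
  have "{\<kappa> \<in> V \<rightarrow>\<^sub>E {0, 1, 2}. \<kappa> x = 0 \<and> \<kappa> y = 1 \<and> \<kappa> z = 2} = PiE V F"
  proof (intro equalityI subsetI)
    fix \<kappa> :: "'a \<Rightarrow> nat" assume "\<kappa> \<in> {\<kappa> \<in> V \<rightarrow>\<^sub>E {0, 1, 2}. \<kappa> x = 0 \<and> \<kappa> y = 1 \<and> \<kappa> z = 2}"
    then show "\<kappa> \<in> PiE V F" by (auto simp: PiE_iff F_def)
  next
    fix \<kappa> assume \<kappa>: "\<kappa> \<in> PiE V F"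
    have "F v \<subseteq> {0, 1, 2}" for v by (simp add: F_def)
    then have "\<kappa> \<in> V \<rightarrow>\<^sub>E {0, 1, 2}" using \<kappa> by (meson PiE_mono subsetD)
    moreover have "\<kappa> x \<in> F x" "\<kappa> y \<in> F y" "\<kappa> z \<in> F z" using \<kappa> xyz by (auto simp: PiE_iff)
    ultimately show "\<kappa> \<in> {\<kappa> \<in> V \<rightarrow>\<^sub>E {0, 1, 2}. \<kappa> x = 0 \<and> \<kappa> y = 1 \<and> \<kappa> z = 2}" using Fx by simp
  qed
  then have "card {\<kappa> \<in> V \<rightarrow>\<^sub>E {0, 1, 2::nat}. \<kappa> x = 0 \<and> \<kappa> y = 1 \<and> \<kappa> z = 2} = (\<Prod>v\<in>V. card (F v))"
    using V by (simp add: card_PiE)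
  also have "\<dots> = (\<Prod>v\<in>V - {x, y, z}. card (F v))"
    using V xyz by (intro prod.mono_neutral_right) (auto simp: Fx)
  also have "\<dots> = (\<Prod>v\<in>V - {x, y, z}. 3)" by (intro prod.cong) (auto simp: F_def)
  also have "27 * \<dots> = 3 ^ (card (V - {x, y, z}) + card {x, y, z})"
    using xyz by (simp add: power_add)
  also have "card (V - {x, y, z}) + card {x, y, z} = card V"
    using V xyz by (metis card_Diff_subset card_mono finite.emptyI finite.insertI insert_subset
        empty_subsetI le_add_diff_inverse2)
  finally show ?thesis .
qed

text \<open>Averaging over all 3-colourings of \<open>V\<close>: each triple is coloured as required
  by exactly one in 27.\<close>

lemma exists_tripartite_colouring:
  assumes V: "finite V" and TV: "T \<subseteq> V \<times> V \<times> V"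
    and dis: "\<And>x y z. (x, y, z) \<in> T \<Longrightarrow> x \<noteq> y \<and> x \<noteq> z \<and> y \<noteq> z"
  obtains \<kappa> :: "'a \<Rightarrow> nat" where "card T \<le> 27 * card {(x, y, z)\<in>T. \<kappa> x = 0 \<and> \<kappa> y = 1 \<and> \<kappa> z = 2}"
proof (rule ccontr)
  define K where "K = V \<rightarrow>\<^sub>E {0, 1, 2::nat}"
  define good where "good \<kappa> t \<longleftrightarrow> (case t of (x, y, z) \<Rightarrow> \<kappa> x = 0 \<and> \<kappa> y = 1 \<and> \<kappa> z = (2::nat))"
    for \<kappa> :: "'a \<Rightarrow> nat" and t
  assume "\<not> thesis"
  then have less: "27 * card {t\<in>T. good \<kappa> t} < card T" for \<kappa>
    using that[of \<kappa>] unfolding good_def by (auto simp: not_le[symmetric] case_prod_unfold)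
  have fT: "finite T" using TV V by (meson finite_SigmaI finite_subset)
  have fK: "finite K" using V by (simp add: K_def finite_PiE)
  have "card {0, 1, 2::nat} = 3" by simp
  then have cK: "card K = 3 ^ card V" using V by (simp only: K_def card_PiE prod_constant)
  have "K \<noteq> {}" using cK by auto
  have "(\<Sum>\<kappa>\<in>K. 27 * card {t\<in>T. good \<kappa> t}) = 27 * (\<Sum>\<kappa>\<in>K. \<Sum>t\<in>{t\<in>T. good \<kappa> t}. 1)"
    by (simp add: sum_distrib_left)
  also have "\<dots> = 27 * (\<Sum>t\<in>T. \<Sum>\<kappa>\<in>{\<kappa>\<in>K. good \<kappa> t}. 1)"
    by (subst sum.swap_restrict[OF fK fT]) simp
  also have "\<dots> = (\<Sum>t\<in>T. 27 * card {\<kappa>\<in>K. good \<kappa> t})" by (simp add: sum_distrib_left)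
  also have "\<dots> = (\<Sum>t\<in>T. card K)"
  proof (rule sum.cong[OF refl], clarify)
    fix x y z assume "(x, y, z) \<in> T"
    then show "27 * card {\<kappa>\<in>K. good \<kappa> (x, y, z)} = card K"
      using card_colourings[OF V, of x y z] dis[of x y z] TV cK by (auto simp: K_def good_def)
  qed
  also have "\<dots> = (\<Sum>\<kappa>\<in>K. card T)" by simp
  finally have "(\<Sum>\<kappa>\<in>K. 27 * card {t\<in>T. good \<kappa> t}) = (\<Sum>\<kappa>\<in>K. card T)" .
  moreover have "(\<Sum>\<kappa>\<in>K. 27 * card {t\<in>T. good \<kappa> t}) < (\<Sum>\<kappa>\<in>K. card T)"
    by (rule sum_strict_mono[OF fK \<open>K \<noteq> {}\<close>]) (rule less)
  ultimately show False by simp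
qed

text \<open>Six points instead of nine need three coincidences. Two triples share at most one
  coordinate, so each pair of triples coincides once, and in different classes; the cases are the
  assignments of pairs to classes.\<close>

lemma triangle_cases:
  assumes "card {x1, x2, x3} + card {y1, y2, y3} + card {z1, z2, z3} \<le> 6"
    "\<not> (x1 = x2 \<and> y1 = y2)" "\<not> (x1 = x2 \<and> z1 = z2)" "\<not> (y1 = y2 \<and> z1 = z2)"
    "\<not> (x1 = x3 \<and> y1 = y3)" "\<not> (x1 = x3 \<and> z1 = z3)" "\<not> (y1 = y3 \<and> z1 = z3)"
    "\<not> (x2 = x3 \<and> y2 = y3)" "\<not> (x2 = x3 \<and> z2 = z3)" "\<not> (y2 = y3 \<and> z2 = z3)"
  shows "x1 = x2 \<and> z1 = z3 \<and> y2 = y3 \<or> x1 = x3 \<and> z1 = z2 \<and> y2 = y3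
    \<or> x2 = x1 \<and> z2 = z3 \<and> y1 = y3 \<or> x2 = x3 \<and> z2 = z1 \<and> y1 = y3
    \<or> x3 = x1 \<and> z3 = z2 \<and> y1 = y2 \<or> x3 = x2 \<and> z3 = z1 \<and> y1 = y2"
  using assms by (auto simp: card_insert_if split: if_splits)

text \<open>The constraints \<open>(x, y, z, w)\<close> with one common \<open>w\<close> and an
  all-zero violation: as \<open>w\<close> gets \<open>Zero\<close>, the other constraints must be
  satisfied through \<open>P_rel\<close>.\<close>

locale zero_witnessed =
  fixes T :: "('a \<times> 'a \<times> 'a) set"
  assumes witness: "(x, y, z) \<in> T \<Longrightarrow> \<exists>\<phi>. \<phi> x = Zero \<and> \<phi> y = Zero \<and> \<phi> z = Zero
      \<and> (\<forall>(x', y', z')\<in>T. (x', y', z') \<noteq> (x, y, z) \<longrightarrow> [\<phi> x', \<phi> y', \<phi> z'] \<in> P_rel)"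
begin

lemma witnessE:
  assumes "(x, y, z) \<in> T"
  obtains \<phi> where "\<phi> x = Zero" "\<phi> y = Zero" "\<phi> z = Zero"
    "\<And>x' y' z'. (x', y', z') \<in> T \<Longrightarrow> (x', y', z') \<noteq> (x, y, z) \<Longrightarrow> [\<phi> x', \<phi> y', \<phi> z'] \<in> P_rel"
proof -
  obtain \<phi> where \<phi>: "\<phi> x = Zero" "\<phi> y = Zero" "\<phi> z = Zero"
    "\<forall>(x', y', z')\<in>T. (x', y', z') \<noteq> (x, y, z) \<longrightarrow> [\<phi> x', \<phi> y', \<phi> z'] \<in> P_rel"
    using witness[OF assms] by blast
  show thesis by (rule that[OF \<phi>(1-3)]) (use \<phi>(4) in auto)
qed

text \<open>No tuple of \<open>P_rel\<close> has two entries \<open>Zero\<close>.\<close>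

lemma linear:
  assumes "(x, y, z) \<in> T" "(x', y', z') \<in> T" "(x', y', z') \<noteq> (x, y, z)"
  shows "\<not> (x = x' \<and> y = y')" "\<not> (x = x' \<and> z = z')" "\<not> (y = y' \<and> z = z')"
proof -
  obtain \<phi> where \<phi>: "\<phi> x = Zero" "\<phi> y = Zero" "\<phi> z = Zero" "[\<phi> x', \<phi> y', \<phi> z'] \<in> P_rel"
    using witnessE[OF assms(1)] assms by metis
  then show "\<not> (x = x' \<and> y = y')" "\<not> (x = x' \<and> z = z')" "\<not> (y = y' \<and> z = z')"
    by (auto simp: P_rel_iff)
qed

text \<open>In \<open>P_rel\<close> a first entry \<open>Zero\<close> forces the middle one to be
  \<open>Neg\<close>, and a last entry \<open>Zero\<close> forces it to be \<open>Pos\<close>; here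
  both would apply to \<open>y'\<close>.\<close>

lemma triangle_free:
  assumes "(x, y, z) \<in> T" "(x, y', z') \<in> T" "(x'', y', z) \<in> T"
    "(x, y', z') \<noteq> (x, y, z)" "(x'', y', z) \<noteq> (x, y, z)"
  shows False
proof -
  obtain \<phi> where \<phi>: "\<phi> x = Zero" "\<phi> y = Zero" "\<phi> z = Zero"
    "[\<phi> x, \<phi> y', \<phi> z'] \<in> P_rel" "[\<phi> x'', \<phi> y', \<phi> z] \<in> P_rel"
    using witnessE[OF assms(1)] assms(2-) by metis
  then show False by (auto simp: P_rel_iff)
qed

text \<open>The colours keep the coordinate classes disjoint, so an edge determines its triple and
  vertex counts add over the classes. Three edges on six vertices then form a triangle, which
  \<open>triangle_free\<close> excludes.\<close>

lemma card_tripartite: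
  fixes \<kappa> :: "'a \<Rightarrow> nat"
  assumes T: "\<And>x y z. (x, y, z) \<in> T \<Longrightarrow> \<kappa> x = 0 \<and> \<kappa> y = 1 \<and> \<kappa> z = 2" and V: "finite V" "T \<subseteq> V \<times> V \<times> V"
  defines "E \<equiv> (\<lambda>(x, y, z). {x, y, z}) ` T"
  shows "uniform_hypergraph 3 V E" "sparse_hypergraph 6 3 V E" "card E = card T"
proof -
  have inj: "(x, y, z) = (x', y', z')"
    if "(x, y, z) \<in> T" "(x', y', z') \<in> T" "{x, y, z} = {x', y', z'}" for x y z x' y' z'
  proof -
    have "x' \<in> {x, y, z}" "y' \<in> {x, y, z}" "z' \<in> {x, y, z}" using that(3) by auto
    then show ?thesis using T[OF that(1)] T[OF that(2)] by auto
  qed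
  show "card E = card T"
    unfolding E_def by (rule card_image) (auto simp: inj_on_def dest: inj)
  have "x \<noteq> y" "x \<noteq> z" "y \<noteq> z" if "(x, y, z) \<in> T" for x y z
    using T[OF that] by auto
  then show "uniform_hypergraph 3 V E"
    using V by (fastforce simp: uniform_hypergraph_def E_def)
  show "sparse_hypergraph 6 3 V E"
    unfolding sparse_hypergraph_def
  proof clarify
    fix W assume W: "W \<subseteq> V" "card W = 6" "3 \<le> card {h\<in>E. h \<subseteq> W}"
    obtain D where D: "D \<subseteq> {h\<in>E. h \<subseteq> W}" "card D = 3" using W(3) by (rule obtain_subset_with_card_n)
    then obtain h1 h2 h3 where h: "D = {h1, h2, h3}" "h1 \<noteq> h2" "h1 \<noteq> h3" "h2 \<noteq> h3"
      by (auto simp: card_3_iff)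
    have mem: "\<exists>x y z. h = {x, y, z} \<and> (x, y, z) \<in> T \<and> x \<in> W \<and> y \<in> W \<and> z \<in> W" if "h \<in> D" for h
    proof -
      have "h \<in> E" "h \<subseteq> W" using D(1) that by auto
      moreover from this obtain x y z where "h = {x, y, z}" "(x, y, z) \<in> T" by (auto simp: E_def)
      ultimately show ?thesis by blast
    qed
    obtain x1 y1 z1 where 1: "h1 = {x1, y1, z1}" "(x1, y1, z1) \<in> T" "x1 \<in> W" "y1 \<in> W" "z1 \<in> W"
      using mem[of h1] h by auto
    obtain x2 y2 z2 where 2: "h2 = {x2, y2, z2}" "(x2, y2, z2) \<in> T" "x2 \<in> W" "y2 \<in> W" "z2 \<in> W"
      using mem[of h2] h by auto
    obtain x3 y3 z3 where 3: "h3 = {x3, y3, z3}" "(x3, y3, z3) \<in> T" "x3 \<in> W" "y3 \<in> W" "z3 \<in> W"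
      using mem[of h3] h by auto
    have ne: "(x1, y1, z1) \<noteq> (x2, y2, z2)" "(x1, y1, z1) \<noteq> (x3, y3, z3)" "(x2, y2, z2) \<noteq> (x3, y3, z3)"
      using h 1 2 3 by auto
    have "finite W" using V W finite_subset by blast
    have "card ({x1, x2, x3} \<union> ({y1, y2, y3} \<union> {z1, z2, z3}))
        = card {x1, x2, x3} + (card {y1, y2, y3} + card {z1, z2, z3})"
      using T[OF 1(2)] T[OF 2(2)] T[OF 3(2)]
      by (subst card_Un_disjoint; (subst card_Un_disjoint)?) auto
    moreover have "card ({x1, x2, x3} \<union> ({y1, y2, y3} \<union> {z1, z2, z3})) \<le> card W"
      using 1 2 3 \<open>finite W\<close> by (intro card_mono) auto
    ultimately have "card {x1, x2, x3} + card {y1, y2, y3} + card {z1, z2, z3} \<le> 6"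
      using W by linarith
    note tri = triangle_cases[OF this linear[OF 1(2) 2(2) ne(1)[symmetric]]
        linear[OF 1(2) 3(2) ne(2)[symmetric]] linear[OF 2(2) 3(2) ne(3)[symmetric]]]
    \<comment> \<open>In every case one triple shares its x with a second and its z with a third,
      and the last two share y.\<close>
    show False
      using tri
    proof (elim disjE conjE)
      assume "x1 = x2" "z1 = z3" "y2 = y3"
      then show False using triangle_free[of x1 y1 z1 y2 z2 x3] 1 2 3 ne by auto
    next
      assume "x1 = x3" "z1 = z2" "y2 = y3"
      then show False using triangle_free[of x1 y1 z1 y3 z3 x2] 1 2 3 ne by auto
    next
      assume "x2 = x1" "z2 = z3" "y1 = y3"
      then show False using triangle_free[of x2 y2 z2 y1 z1 x3] 1 2 3 ne by auto
    next
      assume "x2 = x3" "z2 = z1" "y1 = y3"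
      then show False using triangle_free[of x2 y2 z2 y3 z3 x1] 1 2 3 ne by auto
    next
      assume "x3 = x1" "z3 = z2" "y1 = y2"
      then show False using triangle_free[of x3 y3 z3 y1 z1 x2] 1 2 3 ne by auto
    next
      assume "x3 = x2" "z3 = z1" "y1 = y2"
      then show False using triangle_free[of x3 y3 z3 y2 z2 x1] 1 2 3 ne by auto
    qed
  qed
qed

end

lemma zero_witnessed_subset:
  assumes "zero_witnessed T" "T' \<subseteq> T" shows "zero_witnessed T'"
proof
  fix x y z assume "(x, y, z) \<in> T'"
  then have "(x, y, z) \<in> T" using assms(2) by blast
  then obtain \<phi> where \<phi>: "\<phi> x = Zero" "\<phi> y = Zero" "\<phi> z = Zero"
    "\<And>x' y' z'. (x', y', z') \<in> T \<Longrightarrow> (x', y', z') \<noteq> (x, y, z) \<Longrightarrow> [\<phi> x', \<phi> y', \<phi> z'] \<in> P_rel"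
    using zero_witnessed.witnessE[OF assms(1)] by metis
  then show "\<exists>\<phi>. \<phi> x = Zero \<and> \<phi> y = Zero \<and> \<phi> z = Zero
      \<and> (\<forall>(x', y', z')\<in>T'. (x', y', z') \<noteq> (x, y, z) \<longrightarrow> [\<phi> x', \<phi> y', \<phi> z'] \<in> P_rel)"
    using assms(2) by (intro exI[of _ \<phi>]) auto
qed

text \<open>By linearity two coordinates determine a triple, so at most \<open>n\<close> triples
  have a given pair of coordinates equal; the rest lose a factor 27 in becoming tripartite.\<close>

lemma card_zero_witnessed:
  assumes zw: "zero_witnessed T" and TV: "T \<subseteq> {1..n} \<times> {1..n} \<times> {1..n}"
  shows "card T \<le> 27 * hyp_extremal 3 n 6 3 + 3 * n"
proof -
  have fT: "finite T" using TV by (meson finite_SigmaI finite_atLeastAtMost finite_subset)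
  define D where "D = {(x, y, z)\<in>T. x \<noteq> y \<and> x \<noteq> z \<and> y \<noteq> z}"
  define Dz where "Dz = {(x, y, z)\<in>T. x = y}"
  define Dy where "Dy = {(x, y, z)\<in>T. x = z}"
  define Dx where "Dx = {(x, y, z)\<in>T. y = z}"
  have sub: "D \<subseteq> T" "Dz \<subseteq> T" "Dy \<subseteq> T" "Dx \<subseteq> T" by (auto simp: D_def Dz_def Dy_def Dx_def)
  note lin = zero_witnessed.linear[OF zw]
  have uz: "z = z'" if "(x, y, z) \<in> T" "(x, y, z') \<in> T" for x y z z' using lin(1)[OF that] by auto
  have uy: "y = y'" if "(x, y, z) \<in> T" "(x, y', z) \<in> T" for x y y' z using lin(2)[OF that] by auto
  have ux: "x = x'" if "(x, y, z) \<in> T" "(x', y, z) \<in> T" for x x' y z using lin(3)[OF that] by auto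
  have le: "card X \<le> n" if "inj_on g X" "g ` X \<subseteq> {1..n}" for g :: "nat \<times> nat \<times> nat \<Rightarrow> nat" and X
    using card_inj_on_le[OF that] by simp
  have "card Dz \<le> n"
    by (rule le[of fst]) (use TV in \<open>auto simp: inj_on_def Dz_def intro: uz\<close>)
  moreover have "card Dy \<le> n"
    by (rule le[of fst]) (use TV in \<open>auto simp: inj_on_def Dy_def intro: uy\<close>)
  moreover have "card Dx \<le> n"
    by (rule le[of "\<lambda>t. fst (snd t)"]) (use TV in \<open>auto simp: inj_on_def Dx_def intro: ux\<close>)
  moreover have "card D \<le> 27 * hyp_extremal 3 n 6 3"
  proof -
    obtain \<kappa> :: "nat \<Rightarrow> nat" where \<kappa>: "card D \<le> 27 * card {(x, y, z)\<in>D. \<kappa> x = 0 \<and> \<kappa> y = 1 \<and> \<kappa> z = 2}"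
    proof (rule exists_tripartite_colouring)
      show "finite {1..n}" by simp
      show "D \<subseteq> {1..n} \<times> {1..n} \<times> {1..n}" using sub(1) TV by (rule subset_trans)
      show "x \<noteq> y \<and> x \<noteq> z \<and> y \<noteq> z" if "(x, y, z) \<in> D" for x y z using that by (simp add: D_def)
    qed
    let ?D = "{(x, y, z)\<in>D. \<kappa> x = 0 \<and> \<kappa> y = 1 \<and> \<kappa> z = 2}"
    have "?D \<subseteq> T" using sub by auto
    then interpret zero_witnessed ?D by (rule zero_witnessed_subset[OF zw])
    have DV: "?D \<subseteq> {1..n} \<times> {1..n} \<times> {1..n}" using \<open>?D \<subseteq> T\<close> TV by blast
    have col: "\<kappa> x = 0 \<and> \<kappa> y = 1 \<and> \<kappa> z = 2" if "(x, y, z) \<in> ?D" for x y z using that by simp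
    note tp = card_tripartite[of \<kappa> "{1..n}", OF col finite_atLeastAtMost DV]
    have "card ?D \<le> hyp_extremal 3 n 6 3"
      using hyp_extremal_ge[OF tp(1,2)] tp(3) by simp
    then show ?thesis using \<kappa> by linarith
  qed
  moreover have "card T \<le> card D + card Dz + card Dy + card Dx"
  proof -
    have "T = D \<union> Dz \<union> Dy \<union> Dx" by (auto simp: D_def Dz_def Dy_def Dx_def)
    then have "card T = card (D \<union> Dz \<union> Dy \<union> Dx)" by (rule arg_cong)
    also have "\<dots> \<le> card D + card Dz + card Dy + card Dx"
      by (meson add_mono card_Un_le le_refl order_trans)
    finally show ?thesis .
  qed
  ultimately show ?thesis by simp
qed

section \<open>Assembly of the bounds\<close>

lemma NRD_R_rel_le: "NRD 4 R_rel n \<le> n * (27 * hyp_extremal 3 n 6 3) + 9 * n ^ 2"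
proof -
  have "card C \<le> n * (27 * hyp_extremal 3 n 6 3) + 9 * n ^ 2"
    if C: "csp_instance 4 {1..n} C" "non_redundant R_rel C" for C :: "nat list set"
  proof -
    have CV: "C \<subseteq> tuples 4 {1..n}" using C by (simp add: csp_instance_def)
    have form: "\<exists>x y z w. S = [x, y, z, w] \<and> {x, y, z, w} \<subseteq> {1..n}" if "S \<in> C" for S
    proof -
      have "length S = 4" "set S \<subseteq> {1..n}" using CV that by (auto simp: tuples_def)
      then show ?thesis by (auto simp: numeral_eq_Suc length_Suc_conv)
    qed
    have fC: "finite C" using CV finite_tuples[of "{1..n}" 4] finite_subset by blast
    obtain \<phi> where \<phi>: "\<And>S. S \<in> C \<Longrightarrow> map (\<phi> S) S \<notin> R_rel"
      "\<And>S T. S \<in> C \<Longrightarrow> T \<in> C \<Longrightarrow> T \<noteq> S \<Longrightarrow> map (\<phi> S) T \<in> R_rel"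
      using C(2) unfolding non_redundant_def satisfies_def bchoice_iff by blast
    define tr where "tr S = (S ! 0, S ! 1, S ! 2)" for S :: "nat list"
    define C0 where "C0 = {S\<in>C. \<phi> S (S ! 3) = Neg}"
    define C1 where "C1 = {S\<in>C. map (\<phi> S) (take 3 S) \<notin> Q_rel}"
    define C2 where "C2 = {S\<in>C. map (\<phi> S) S = [Zero, Zero, Zero, Zero]}"
    have sub: "C0 \<subseteq> C" "C1 \<subseteq> C" "C2 \<subseteq> C" by (auto simp: C0_def C1_def C2_def)
    \<comment> \<open>If the triple lies in \<open>Q_rel\<close> and w is not \<open>Neg\<close>, a
      violation requires w to be \<open>Zero\<close> and the triple to be the one tuple of
      \<open>Q_rel\<close> outside \<open>P_rel\<close>.\<close>
    have "C \<subseteq> C0 \<union> C1 \<union> C2"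
    proof
      fix S assume S: "S \<in> C"
      then obtain x y z w where s: "S = [x, y, z, w]" using form by blast
      have "[\<phi> S x, \<phi> S y, \<phi> S z, \<phi> S w] \<notin> R_rel" using \<phi>(1)[OF S] s by simp
      then show "S \<in> C0 \<union> C1 \<union> C2"
        using S s by (cases "\<phi> S w") (auto simp: C0_def C1_def C2_def R_rel_iff Q_rel_iff)
    qed
    then have "card C \<le> card (C0 \<union> C1 \<union> C2)"
      using sub fC by (intro card_mono) (auto intro: finite_subset)
    also have "\<dots> \<le> card C0 + card C1 + card C2" by (meson add_mono card_Un_le le_refl order_trans)
    finally have split: "card C \<le> card C0 + card C1 + card C2" .
    have c0: "card C0 \<le> n"
    proof -
      \<comment> \<open>An assignment giving \<open>Neg\<close> to w violates every constraint
        ending in w.\<close>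
      have "inj_on (\<lambda>S. S ! 3) C0"
      proof (rule inj_onI, rule ccontr)
        fix S T assume ST: "S \<in> C0" "T \<in> C0" "S ! 3 = T ! 3" "S \<noteq> T"
        then have "map (\<phi> S) T \<in> R_rel" by (intro \<phi>(2)) (auto simp: C0_def)
        moreover obtain x y z w where "T = [x, y, z, w]" using form ST sub by blast
        ultimately show False using ST by (auto simp: C0_def R_rel_iff)
      qed
      moreover have "(\<lambda>S. S ! 3) ` C0 \<subseteq> {1..n}" using form sub(1) by fastforce
      ultimately show ?thesis using card_inj_on_le[of _ C0 "{1..n}"] by fastforce
    qed
    have c1: "card C1 \<le> 5 * n ^ 2"
    proof -
      \<comment> \<open>\<open>R_rel\<close> forces the first three values into
        \<open>Q_rel\<close>, so dropping w keeps the constraints of \<open>C1\<close> distinct and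
        non-redundant for \<open>Q_rel\<close>.\<close>
      have Q: "map (\<phi> S) (take 3 T) \<in> Q_rel" if ST: "S \<in> C1" "T \<in> C1" "T \<noteq> S" for S T
      proof -
        obtain x y z w where t: "T = [x, y, z, w]" using form[of T] ST sub by blast
        have "map (\<phi> S) T \<in> R_rel" using ST sub by (intro \<phi>(2)) auto
        then show ?thesis by (auto simp: t R_rel_iff Q_rel_iff)
      qed
      have tr3: "take 3 S = [x, y, z]" if "S \<in> C" "tr S = (x, y, z)" for S x y z
        using form[OF that(1)] that(2) by (auto simp: tr_def)
      have inj: "inj_on tr C1"
      proof (rule inj_onI, rule ccontr)
        fix S T assume ST: "S \<in> C1" "T \<in> C1" "tr S = tr T" "S \<noteq> T"
        then have "take 3 S = take 3 T" using sub tr3 by (metis prod_cases3 subsetD)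
        then show False using Q[of S T] ST by (auto simp: C1_def)
      qed
      have "card (tr ` C1) \<le> 5 * card {1..n} ^ 2"
      proof (rule card_non_redundant_Q)
        show "tr ` C1 \<subseteq> {1..n} \<times> {1..n} \<times> {1..n}"
          using form sub(2) by (fastforce simp: tr_def)
        fix x y z assume "(x, y, z) \<in> tr ` C1"
        then obtain S where S: "S \<in> C1" "tr S = (x, y, z)" by auto
        have "[\<phi> S x, \<phi> S y, \<phi> S z] \<notin> Q_rel"
          using S tr3[of S] sub by (auto simp: C1_def)
        moreover have "[\<phi> S x', \<phi> S y', \<phi> S z'] \<in> Q_rel"
          if t: "(x', y', z') \<in> tr ` C1" "(x', y', z') \<noteq> (x, y, z)" for x' y' z'
        proof -
          obtain U where U: "U \<in> C1" "tr U = (x', y', z')" using t by auto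
          then have "U \<noteq> S" using t(2) S(2) by metis
          then have "map (\<phi> S) (take 3 U) \<in> Q_rel" by (rule Q[OF S(1) U(1)])
          then show ?thesis using tr3[of U x' y' z'] U sub by auto
        qed
        ultimately show "\<exists>\<phi>. [\<phi> x, \<phi> y, \<phi> z] \<notin> Q_rel \<and>
          (\<forall>(x', y', z')\<in>tr ` C1. (x', y', z') \<noteq> (x, y, z) \<longrightarrow> [\<phi> x', \<phi> y', \<phi> z'] \<in> Q_rel)"
          by (intro exI[of _ "\<phi> S"]) blast
      qed simp
      then show ?thesis using inj by (simp add: card_image)
    qed
    have c2: "card C2 \<le> card {1..n} * (27 * hyp_extremal 3 n 6 3 + 3 * n)"
    proof (rule card_fibres_le[of _ _ "\<lambda>S. S ! 3"])
      show "finite C2" using sub fC finite_subset by blast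
      show "(\<lambda>S. S ! 3) ` C2 \<subseteq> {1..n}" using form sub(3) by fastforce
      fix w
      let ?T = "{(x, y, z). [x, y, z, w] \<in> C2}"
      have "zero_witnessed ?T"
      proof
        fix x y z assume "(x, y, z) \<in> ?T"
        then have S: "[x, y, z, w] \<in> C2" by simp
        let ?p = "\<phi> [x, y, z, w]"
        have p: "?p x = Zero" "?p y = Zero" "?p z = Zero" "?p w = Zero" using S by (auto simp: C2_def)
        have "[?p x', ?p y', ?p z'] \<in> P_rel"
          if "(x', y', z') \<in> ?T" "(x', y', z') \<noteq> (x, y, z)" for x' y' z'
        proof -
          have "map ?p [x', y', z', w] \<in> R_rel" using S that sub by (intro \<phi>(2)) auto
          then show ?thesis using p by (simp add: R_rel_iff)
        qed
        then show "\<exists>\<phi>. \<phi> x = Zero \<and> \<phi> y = Zero \<and> \<phi> z = Zero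
          \<and> (\<forall>(x', y', z')\<in>?T. (x', y', z') \<noteq> (x, y, z) \<longrightarrow> [\<phi> x', \<phi> y', \<phi> z'] \<in> P_rel)"
          using p by (intro exI[of _ ?p]) auto
      qed
      moreover have "?T \<subseteq> {1..n} \<times> {1..n} \<times> {1..n}" using form sub(3) by fastforce
      ultimately have "card ?T \<le> 27 * hyp_extremal 3 n 6 3 + 3 * n" by (rule card_zero_witnessed)
      moreover have "bij_betw (\<lambda>(x, y, z). [x, y, z, w]) ?T {S\<in>C2. S ! 3 = w}"
      proof -
        have "S \<in> (\<lambda>(x, y, z). [x, y, z, w]) ` ?T" if S: "S \<in> C2" "S ! 3 = w" for S
        proof -
          obtain x y z w' where "S = [x, y, z, w']" using form S sub by blast
          then show ?thesis using S by (auto intro!: image_eqI[of _ _ "(x, y, z)"])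
        qed
        then show ?thesis by (auto simp: bij_betw_def inj_on_def)
      qed
      ultimately show "card {S\<in>C2. S ! 3 = w} \<le> 27 * hyp_extremal 3 n 6 3 + 3 * n"
        using bij_betw_same_card by fastforce
    qed simp
    have "card C \<le> n + 5 * n ^ 2 + n * (27 * hyp_extremal 3 n 6 3 + 3 * n)"
      using split c0 c1 c2 by simp
    also have "\<dots> = n + 8 * n ^ 2 + n * (27 * hyp_extremal 3 n 6 3)"
      by (simp add: algebra_simps power2_eq_square)
    finally have "card C \<le> n + 8 * n ^ 2 + n * (27 * hyp_extremal 3 n 6 3)" .
    moreover have "n \<le> n ^ 2" by (simp add: power2_eq_square)
    ultimately show ?thesis by linarith
  qed
  then show ?thesis
    unfolding NRD_def by (subst Max_le_iff) (use NRD_sizes[where R = R_rel and r = 4 and n = n] in auto)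
qed

text \<open>Turns the term \<open>9 * n ^ 2\<close> into a multiple of \<open>n\<close> times the
  extremal number.\<close>

lemma le_five_hyp_extremal: "n \<ge> 3 \<Longrightarrow> n \<le> 5 * hyp_extremal 3 n 6 3"
proof -
  assume "n \<ge> 3"
  then have "n \<le> 5 * (n div 3)" by presburger
  then show ?thesis using hyp_extremal_lower[of n] by linarith
qed

theorem theorem3p5:
  "\<exists>(c1::real) (c2::real) (c3::real) (n0::nat). c1 > 0 \<and> c2 > 0 \<and> c3 > 0 \<and>
     (\<forall>n::nat. n \<ge> n0 \<longrightarrow>
        real (NRD 4 R_rel n) \<le> c1 * real n * real (hyp_extremal 3 n 6 3) \<and>
        c1 * real n * real (hyp_extremal 3 n 6 3)
          \<le> real n ^ 3 / 2 powr (c2 * real (log_star (real n))) \<and>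
        real (CL 4 R_rel n) \<ge> c3 * real n ^ 3)"
proof (intro exI conjI allI impI)
  \<comment> \<open>72 is \<open>27 + 9 * 5\<close>. With \<open>hyp_extremal_upper\<close> it
    becomes \<open>216 = 3 * 72\<close>, absorbed by halving the exponent 1/100. The value 1/1000
    comes from \<open>n div 5 \<ge> n / 10\<close>.\<close>
  let ?c1 = "72 :: real" and ?c2 = "1/200 :: real" and ?c3 = "1/1000 :: real"
  show "?c1 > 0" "?c2 > 0" "?c3 > 0" by simp_all
  fix n :: nat
  \<comment> \<open>Here the iterated logarithm is at least 1600, so \<open>2 powr (l / 200)\<close>
    is at least \<open>2 ^ 8\<close>, which exceeds 216.\<close>
  assume n: "n \<ge> tower 1600 + 1"
  define f where "f = hyp_extremal 3 n 6 3"
  define l where "l = log_star n"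
  have n8: "n \<ge> 8" using n less_tower[of 1600] by linarith
  have l: "l \<ge> 1600"
  proof (rule ccontr)
    assume "\<not> l \<ge> 1600"
    then have "tower l \<le> tower 1600" by (intro tower_mono) simp
    moreover have "n \<le> tower l" using le_tower_log_star[of "real n"] by (simp add: l_def)
    ultimately show False using n by linarith
  qed
  have "NRD 4 R_rel n \<le> n * (27 * f) + 9 * n ^ 2" unfolding f_def by (rule NRD_R_rel_le)
  also have "9 * n ^ 2 \<le> 9 * (n * (5 * f))"
    unfolding power2_eq_square f_def using n8 by (intro mult_left_mono le_five_hyp_extremal) auto
  finally have "NRD 4 R_rel n \<le> n * (27 * f) + 9 * (n * (5 * f))" by simp
  also have "\<dots> = 72 * (n * f)" by (simp add: algebra_simps)
  finally have "NRD 4 R_rel n \<le> 72 * (n * f)" .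
  then have "real (NRD 4 R_rel n) \<le> real (72 * (n * f))" by (simp only: of_nat_le_iff)
  then show "real (NRD 4 R_rel n) \<le> ?c1 * real n * real (hyp_extremal 3 n 6 3)"
    by (simp add: f_def)
  have "(216::real) \<le> 2 powr 8" by simp
  also have "\<dots> \<le> 2 powr (real l / 200)" using l by (intro powr_mono) auto
  finally have "216 * 2 powr (- real l / 100) \<le> 2 powr (real l / 200) * 2 powr (- real l / 100)"
    by (intro mult_right_mono) auto
  also have "\<dots> = 2 powr (- (?c2 * real l))"
    unfolding powr_add[symmetric] by (rule arg_cong[of _ _ "(powr) 2"]) simp
  also have "\<dots> = 1 / 2 powr (?c2 * real l)" by (rule powr_minus_divide)
  finally have p: "216 * 2 powr (- real l / 100) \<le> 1 / 2 powr (?c2 * real l)" .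
  have fu: "real f \<le> 3 * 2 powr (- real l / 100) * real n ^ 2"
    using hyp_extremal_upper[of n] l unfolding f_def l_def by simp
  have "?c1 * real n * real f \<le> ?c1 * real n * (3 * 2 powr (- real l / 100) * n ^ 2)"
    using fu by (intro mult_left_mono) auto
  also have "\<dots> = (216 * 2 powr (- real l / 100)) * real n ^ 3"
    by (simp add: power3_eq_cube power2_eq_square)
  also have "\<dots> \<le> (1 / 2 powr (?c2 * real l)) * real n ^ 3" using p by (rule mult_right_mono) simp
  finally show "?c1 * real n * real (hyp_extremal 3 n 6 3)
      \<le> real n ^ 3 / 2 powr (?c2 * real (log_star (real n)))"
    by (simp add: f_def l_def)
  have "real n / 10 \<le> real (n div 5)" using n8 by linarith
  then have "(real n / 10) ^ 3 \<le> real (n div 5) ^ 3" by (intro power_mono) auto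
  also have "\<dots> \<le> real (CL 4 R_rel n)" using CL_R_rel_ge[of n] by (metis of_nat_le_iff of_nat_power)
  finally show "real (CL 4 R_rel n) \<ge> ?c3 * real n ^ 3" by (simp add: power_divide)
qed

end
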